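(* Let $\mathsf E:\mathcal A\to\mathcal L(\mathcal H)$ be a POVM and $f:\Omega\to\mathbb C$ an $\mathcal A$-measurable function. Suppose that $\mathsf E$ is projection valued. Then $$\tilde L(f,\mathsf E)=L(f,\mathsf E)=L'(f,\mathsf E).$$
   Context: $(\Omega,\mathcal A)$ is a measurable space, $\mathcal H$ a complex Hilbert space with inner product $\langle\cdot|\cdot\rangle$ linear in the second argument, $\mathcal L(\mathcal H)$ the bounded operators. A POVM is a strongly $\sigma$-additive map $\mathsf E:\mathcal A\to\mathcal L(\mathcal H)$ with $\mathsf E(X)\ge0$ for all $X$; it is projection valued if every $\mathsf E(X)$ is an (orthogonal) projection. $\mathsf E_{\psi,\varphi}$ is the complex measure $X\mapsto\langle\psi|\mathsf E(X)\varphi\rangle$. Three operator integrals: - $L(f,\mathsf E)$ (maximal strong operator integral) has domain $D(f,\mathsf E)=\{\varphi\in\mathcal H:\int|f|\,d|\mathsf E_{\psi,\varphi}|<\infty\text{ for all }\psi\in\mathcal H\}$ and $\langle\psi|L(f,\mathsf E)\varphi\rangle=\int f\,d\mathsf E_{\psi,\varphi}$ for all $\psi\in\mathcal H$. - $\tilde L(f,\mathsf E)$ is the restriction of $L(f,\mathsf E)$ to the square integrability domain $\tilde D(f,\mathsf E)=\{\varphi\in\mathcal H:\int|f|^2\,d\mathsf E_{\varphi,\varphi}<\infty\}$, which is a linear subspace contained in $D(f,\mathsf E)$. - $L'(f,\mathsf E)$ (largest symmetric weak operator integral): let $\mathcal D_F(f,\mathsf E)=\{\varphi\in\mathcal H:\int|f|\,d\mathsf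 E_{\varphi,\varphi}<\infty\}$, a linear subspace on which $f$ is $\mathsf E_{\psi,\varphi}$-integrable for all $\psi,\varphi\in\mathcal D_F(f,\mathsf E)$. When $\mathcal D_F(f,\mathsf E)$ is dense (which is the case for projection valued $\mathsf E$), $L'(f,\mathsf E)$ is the linear operator with domain $\{\varphi\in\mathcal D_F(f,\mathsf E):\mathcal D_F(f,\mathsf E)\ni\psi\mapsto\int f\,d\mathsf E_{\psi,\varphi}\text{ is (norm) continuous}\}$ determined by $\langle\psi|L'(f,\mathsf E)\varphi\rangle=\int f\,d\mathsf E_{\psi,\varphi}$ for all $\psi\in\mathcal D_F(f,\mathsf E)$. Equality of operators includes equality of domains. *)

theory Defs
  imports "HOL-Analysis.Analysis"
begin

section \<open>Complex Hilbert spaces\<close>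

text \<open>
  The inner product is antilinear in the first and linear in the second argument.
  The axiom \<open>cinner_self\<close> makes it positive definite and says that the norm
  (and with it the topology and the completeness provided by \<^class>\<open>banach\<close>)
  is the one it induces. The space may be zero and need not be separable.
\<close>

class chilbert_space = banach +
  fixes scaleC :: "complex \<Rightarrow> 'a \<Rightarrow> 'a"  (infixr "*\<^sub>C" 75)
    and cinner :: "'a \<Rightarrow> 'a \<Rightarrow> complex"
  assumes scaleC_of_real: "of_real r *\<^sub>C x = r *\<^sub>R x"
    and scaleC_add_right: "c *\<^sub>C (x + y) = c *\<^sub>C x + c *\<^sub>C y"
    and scaleC_add_left: "(c + d) *\<^sub>C x = c *\<^sub>C x + d *\<^sub>C x"
    and scaleC_scaleC: "c *\<^sub>C d *\<^sub>C x = (c * d) *\<^sub>C x"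
    and cinner_commute: "cinner x y = cnj (cinner y x)"
    and cinner_add_right: "cinner x (y + z) = cinner x y + cinner x z"
    and cinner_scaleC_right: "cinner x (c *\<^sub>C y) = c * cinner x y"
    and cinner_self: "cinner x x = of_real ((norm x)\<^sup>2)"

instantiation complex :: chilbert_space
begin

definition scaleC_complex :: "complex \<Rightarrow> complex \<Rightarrow> complex"
  where "scaleC_complex c x = c * x"

definition cinner_complex :: "complex \<Rightarrow> complex \<Rightarrow> complex"
  where "cinner_complex x y = cnj x * y"

instance
  by standard
    (simp_all add: scaleC_complex_def cinner_complex_def scaleR_conv_of_real algebra_simps
      complex_norm_square del: of_real_power)

end

definition bounded_clinear :: "('h::chilbert_space \<Rightarrow> 'h) \<Rightarrow> bool"
  where "bounded_clinear T \<longleftrightarrow> bounded_linear T \<and> (\<forall>c x. T (c *\<^sub>C x) = c *\<^sub>C T x)"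

definition positive_operator :: "('h::chilbert_space \<Rightarrow> 'h) \<Rightarrow> bool"
  where "positive_operator T \<longleftrightarrow>
    bounded_clinear T \<and> (\<forall>\<phi>. cinner \<phi> (T \<phi>) \<in> \<real>\<^sub>\<ge>\<^sub>0)"

definition orthogonal_projection :: "('h::chilbert_space \<Rightarrow> 'h) \<Rightarrow> bool"
  where "orthogonal_projection P \<longleftrightarrow>
    bounded_clinear P \<and> (\<forall>\<phi>. P (P \<phi>) = P \<phi>) \<and> (\<forall>\<psi> \<phi>. cinner \<psi> (P \<phi>) = cinner (P \<psi>) \<phi>)"


section \<open>Complex measures\<close>

text \<open>
  Throughout, \<open>M\<close> only serves as the measurable space
  \<^term>\<open>(space M, sets M)\<close>; its measure is never used.
\<close>

definition complex_measure :: "'o measure \<Rightarrow> ('o set \<Rightarrow> complex) \<Rightarrow> bool"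
  where "complex_measure M \<mu> \<longleftrightarrow>
    (\<forall>A. range A \<subseteq> sets M \<and> disjoint_family A \<longrightarrow> (\<lambda>n::nat. \<mu> (A n)) sums \<mu> (\<Union>n. A n))"

definition total_variation :: "'o measure \<Rightarrow> ('o set \<Rightarrow> complex) \<Rightarrow> 'o measure"
  where "total_variation M \<mu> = measure_of (space M) (sets M)
    (\<lambda>X. SUP P \<in> {P. finite P \<and> P \<subseteq> sets M \<and> partition_on X P}. \<Sum>A\<in>P. ennreal (cmod (\<mu> A)))"

text \<open>
  The positive part of a signed measure \<open>\<nu>\<close>. Negative values are clipped by
  \<^const>\<open>ennreal\<close>, which does not affect the supremum because
  \<open>\<nu> {} = 0\<close>. The negative part is the positive part of \<open>-\<nu>\<close>.
\<close>

definition positive_variation :: "'o measure \<Rightarrow> ('o set \<Rightarrow> real) \<Rightarrow> 'o measure"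
  where "positive_variation M \<nu> = measure_of (space M) (sets M)
    (\<lambda>X. SUP A \<in> {A \<in> sets M. A \<subseteq> X}. ennreal (\<nu> A))"

text \<open>
  The integral is taken with respect to the Jordan decompositions of the real and the
  imaginary part of \<open>\<mu>\<close>. It is meaningful when \<open>\<bar>f\<bar>\<close> has a finite
  integral with respect to the total variation of \<open>\<mu>\<close>.
\<close>

definition cm_integral :: "'o measure \<Rightarrow> ('o set \<Rightarrow> complex) \<Rightarrow> ('o \<Rightarrow> complex) \<Rightarrow> complex"
  where "cm_integral M \<mu> f =
    (integral\<^sup>L (positive_variation M (\<lambda>X. Re (\<mu> X))) f
      - integral\<^sup>L (positive_variation M (\<lambda>X. - Re (\<mu> X))) f)
    + \<i> * (integral\<^sup>L (positive_variation M (\<lambda>X. Im (\<mu> X))) f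
      - integral\<^sup>L (positive_variation M (\<lambda>X. - Im (\<mu> X))) f)"

text \<open>
  \<^const>\<open>measure_of\<close> yields the zero measure when applied to a set function that is
  not countably additive. The lemmas \<open>emeasure_total_variation\<close>,
  \<open>emeasure_positive_variation\<close>, \<open>complex_measure_povm_cm\<close> and
  \<open>emeasure_povm_diag\<close> show that this does not happen here.
\<close>

lemma complex_measure_empty:
  assumes "complex_measure M \<mu>"
  shows "\<mu> {} = 0"
proof -
  have "(\<lambda>n::nat. \<mu> {}) sums \<mu> {}"
    using assms[unfolded complex_measure_def, rule_format, of "\<lambda>_. {}"]
    by (auto simp: disjoint_family_on_def)
  then show ?thesis
    using sums_summable summable_const_iff by blast
qed

lemma countably_additive_sup:
  fixes M :: "'o measure" and V :: "'o set \<Rightarrow> ennreal"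
  assumes empty: "V {} = 0"
    and mono: "\<And>X Y. X \<in> sets M \<Longrightarrow> Y \<in> sets M \<Longrightarrow> X \<subseteq> Y \<Longrightarrow> V X \<le> V Y"
    and super: "\<And>X Y. X \<in> sets M \<Longrightarrow> Y \<in> sets M \<Longrightarrow> X \<inter> Y = {} \<Longrightarrow> V X + V Y \<le> V (X \<union> Y)"
    and sub: "\<And>A. range A \<subseteq> sets M \<Longrightarrow> disjoint_family A \<Longrightarrow> V (\<Union>n. A n) \<le> (\<Sum>n::nat. V (A n))"
  shows "countably_additive (sets M) V"
proof (rule countably_additiveI)
  fix A :: "nat \<Rightarrow> 'o set"
  assume A: "range A \<subseteq> sets M" "disjoint_family A"
  have *: "(\<Sum>n<N. V (A n)) \<le> V (\<Union>n<N. A n)" for N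
  proof (induction N)
    case (Suc N)
    have "(\<Union>n<N. A n) \<inter> A N = {}"
      using disjoint_family_onD[OF A(2)] by (auto simp: nat_neq_iff)
    moreover have "(\<Union>n<N. A n) \<in> sets M" "A N \<in> sets M"
      using A(1) by auto
    ultimately have "V (\<Union>n<N. A n) + V (A N) \<le> V ((\<Union>n<N. A n) \<union> A N)"
      by (intro super)
    moreover have "(\<Union>n<Suc N. A n) = (\<Union>n<N. A n) \<union> A N"
      by (auto simp: lessThan_Suc)
    ultimately show ?case
      using add_right_mono[OF Suc, of "V (A N)"]
      by (simp only: sum.lessThan_Suc)
  qed (simp add: empty)
  have "(\<Sum>n. V (A n)) \<le> V (\<Union>n. A n)"
  proof (rule suminf_le_const)
    fix N
    have "V (\<Union>n<N. A n) \<le> V (\<Union>n. A n)"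
      using A(1) by (intro mono) auto
    with * show "(\<Sum>n<N. V (A n)) \<le> V (\<Union>n. A n)"
      by (rule order_trans)
  qed auto
  with sub[OF A] show "(\<Sum>n. V (A n)) = V (\<Union>n. A n)"
    by simp
qed

lemma SUP_add_SUP_le:
  fixes f :: "'i \<Rightarrow> ennreal" and g :: "'j \<Rightarrow> ennreal"
  assumes "I \<noteq> {}" "J \<noteq> {}" and le: "\<And>i j. i \<in> I \<Longrightarrow> j \<in> J \<Longrightarrow> f i + g j \<le> c"
  shows "(SUP i\<in>I. f i) + (SUP j\<in>J. g j) \<le> c"
proof -
  have "(SUP i\<in>I. f i) + g j \<le> c" if "j \<in> J" for j
    unfolding ennreal_SUP_add_left[OF assms(1), symmetric] using that le by (auto intro: SUP_least)
  then show ?thesis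
    unfolding ennreal_SUP_add_right[OF assms(2)] by (auto intro: SUP_least)
qed

lemma emeasure_total_variation:
  fixes M :: "'o measure"
  assumes \<mu>: "complex_measure M \<mu>" and X: "X \<in> sets M"
  shows "emeasure (total_variation M \<mu>) X =
    (SUP P \<in> {P. finite P \<and> P \<subseteq> sets M \<and> partition_on X P}. \<Sum>A\<in>P. ennreal (cmod (\<mu> A)))"
proof -
  let ?P = "\<lambda>X. {P. finite P \<and> P \<subseteq> sets M \<and> partition_on X P}"
  let ?S = "\<lambda>P. \<Sum>A\<in>P. ennreal (cmod (\<mu> A))"
  let ?V = "\<lambda>X. SUP P \<in> ?P X. ?S P"
  have ne: "?P X \<noteq> {}" if "X \<in> sets M" for X
  proof (cases "X = {}")
    case True
    then show ?thesis by (auto simp: partition_on_empty)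
  next
    case False
    then have "{X} \<in> ?P X" using that by (auto intro: partition_on_space)
    then show ?thesis by blast
  qed
  have V_empty: "?V {} = 0"
    by (simp add: partition_on_empty)
  have super: "?V X + ?V Y \<le> ?V (X \<union> Y)"
    if XY: "X \<in> sets M" "Y \<in> sets M" "X \<inter> Y = {}" for X Y
  proof -
    have "?S P + ?S Q \<le> ?V (X \<union> Y)" if P: "P \<in> ?P X" and Q: "Q \<in> ?P Y" for P Q
    proof -
      have "P \<inter> Q = {}"
      proof (rule ccontr)
        assume "P \<inter> Q \<noteq> {}"
        then obtain A where "A \<in> P" "A \<in> Q" by blast
        then have "A \<subseteq> X" "A \<subseteq> Y" "A \<noteq> {}"
          using P Q by (auto simp: partition_on_def)
        with XY show False by blast
      qed
      then have "?S P + ?S Q = ?S (P \<union> Q)"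
        using P Q by (intro sum.union_disjoint[symmetric]) auto
      moreover have "P \<union> Q \<in> ?P (X \<union> Y)"
        using P Q XY(3) by (simp add: partition_on_def disjoint_union)
      ultimately show ?thesis
        using SUP_upper[of "P \<union> Q" "?P (X \<union> Y)" ?S] by simp
    qed
    then show ?thesis
      by (rule SUP_add_SUP_le[OF ne[OF XY(1)] ne[OF XY(2)]])
  qed
  have mono: "?V X \<le> ?V Y" if "X \<in> sets M" "Y \<in> sets M" "X \<subseteq> Y" for X Y
  proof -
    have "?V X \<le> ?V X + ?V (Y - X)" by simp
    also have "\<dots> \<le> ?V (X \<union> (Y - X))" using that by (intro super) auto
    also have "X \<union> (Y - X) = Y" using that by auto
    finally show ?thesis .
  qed
  have sub: "?V (\<Union>n. A n) \<le> (\<Sum>n. ?V (A n))"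
    if A: "range A \<subseteq> sets M" "disjoint_family A" for A :: "nat \<Rightarrow> 'o set"
  proof (rule SUP_least)
    fix P assume P: "P \<in> ?P (\<Union>n. A n)"
    have "?S P \<le> (\<Sum>B\<in>P. \<Sum>n. ennreal (cmod (\<mu> (A n \<inter> B))))"
    proof (rule sum_mono)
      fix B assume B: "B \<in> P"
      have "(\<Union>n. A n \<inter> B) = B"
        using P B by (auto simp: partition_on_def)
      moreover have "disjoint_family (\<lambda>n. A n \<inter> B)"
        using A(2) by (auto simp: disjoint_family_on_def)
      ultimately have sums: "(\<lambda>n. \<mu> (A n \<inter> B)) sums \<mu> B"
        using \<mu>[unfolded complex_measure_def, rule_format, of "\<lambda>n. A n \<inter> B"] A(1) B P
        by (simp add: image_subset_iff sets.Int subset_eq)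
      show "ennreal (cmod (\<mu> B)) \<le> (\<Sum>n. ennreal (cmod (\<mu> (A n \<inter> B))))"
      proof (rule LIMSEQ_le_const2)
        show "(\<lambda>N. ennreal (cmod (\<Sum>n<N. \<mu> (A n \<inter> B)))) \<longlonglongrightarrow> ennreal (cmod (\<mu> B))"
          using sums unfolding sums_def by (intro tendsto_ennrealI tendsto_norm)
        have "ennreal (cmod (\<Sum>n<N. \<mu> (A n \<inter> B))) \<le> (\<Sum>n. ennreal (cmod (\<mu> (A n \<inter> B))))" for N
        proof -
          have "ennreal (cmod (\<Sum>n<N. \<mu> (A n \<inter> B))) \<le> (\<Sum>n<N. ennreal (cmod (\<mu> (A n \<inter> B))))"
            by (simp add: norm_sum sum_ennreal ennreal_leI)
          also have "\<dots> \<le> (\<Sum>n. ennreal (cmod (\<mu> (A n \<inter> B))))"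
            by (intro sum_le_suminf) auto
          finally show ?thesis .
        qed
        then show "\<exists>N. \<forall>n\<ge>N. ennreal (cmod (\<Sum>n<n. \<mu> (A n \<inter> B))) \<le> (\<Sum>n. ennreal (cmod (\<mu> (A n \<inter> B))))"
          by blast
      qed
    qed
    also have "\<dots> = (\<Sum>n. \<Sum>B\<in>P. ennreal (cmod (\<mu> (A n \<inter> B))))"
      by (intro suminf_sum[symmetric]) auto
    also have "\<dots> \<le> (\<Sum>n. ?V (A n))"
    proof (intro suminf_le allI)
      fix n
      let ?Q = "(\<inter>) (A n) ` P - {{}}"
      have "A n \<inter> (\<Union>n. A n) = A n" by blast
      then have "?Q \<in> ?P (A n)"
        using P A(1) partition_on_restrict[of "\<Union>n. A n" P "A n"] by auto
      moreover have "(\<Sum>B\<in>P. ennreal (cmod (\<mu> (A n \<inter> B)))) = ?S ?Q"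
      proof -
        let ?P' = "{B \<in> P. A n \<inter> B \<noteq> {}}"
        have inj: "inj_on ((\<inter>) (A n)) ?P'"
        proof (rule inj_onI)
          fix B C assume "B \<in> ?P'" "C \<in> ?P'" "A n \<inter> B = A n \<inter> C"
          then have "B \<inter> C \<noteq> {}" "B \<in> P" "C \<in> P" by auto
          then show "B = C"
            using P disjointD[of P B C] by (metis mem_Collect_eq partition_onD2)
        qed
        have "(\<Sum>B\<in>P. ennreal (cmod (\<mu> (A n \<inter> B)))) = (\<Sum>B\<in>?P'. ennreal (cmod (\<mu> (A n \<inter> B))))"
          using P complex_measure_empty[OF \<mu>] by (intro sum.mono_neutral_right) auto
        also have "\<dots> = ?S ((\<inter>) (A n) ` ?P')"
          by (simp add: sum.reindex[OF inj])
        also have "(\<inter>) (A n) ` ?P' = ?Q" by auto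
        finally show ?thesis .
      qed
      ultimately show "(\<Sum>B\<in>P. ennreal (cmod (\<mu> (A n \<inter> B)))) \<le> ?V (A n)"
        using SUP_upper[of ?Q "?P (A n)" ?S] by simp
    qed auto
    finally show "?S P \<le> (\<Sum>n. ?V (A n))" .
  qed
  show ?thesis
  proof (rule emeasure_measure_of[OF total_variation_def])
    have [simp]: "sets (total_variation M \<mu>) = sets M"
      by (simp add: total_variation_def)
    show "sets M \<subseteq> Pow (space M)"
      by (rule sets.space_closed)
    show "positive (sets (total_variation M \<mu>)) ?V"
      unfolding positive_def by (rule V_empty)
    show "countably_additive (sets (total_variation M \<mu>)) ?V"
      unfolding \<open>sets (total_variation M \<mu>) = sets M\<close>
    proof (rule countably_additive_sup)
      show "?V {} = 0" by (rule V_empty)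
      show "?V X \<le> ?V Y" if "X \<in> sets M" "Y \<in> sets M" "X \<subseteq> Y" for X Y
        using that by (rule mono)
      show "?V X + ?V Y \<le> ?V (X \<union> Y)" if "X \<in> sets M" "Y \<in> sets M" "X \<inter> Y = {}" for X Y
        using that by (rule super)
      show "?V (\<Union>n. A n) \<le> (\<Sum>n::nat. ?V (A n))" if "range A \<subseteq> sets M" "disjoint_family A" for A
        using that by (rule sub)
    qed
    show "X \<in> sets (total_variation M \<mu>)"
      using X by simp
  qed
qed

lemma emeasure_positive_variation:
  fixes M :: "'o measure" and \<nu> :: "'o set \<Rightarrow> real"
  assumes \<nu>: "complex_measure M (\<lambda>X. of_real (\<nu> X))" and X: "X \<in> sets M"
  shows "emeasure (positive_variation M \<nu>) X = (SUP A \<in> {A \<in> sets M. A \<subseteq> X}. ennreal (\<nu> A))"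
proof -
  let ?P = "\<lambda>X. {A \<in> sets M. A \<subseteq> X}"
  let ?V = "\<lambda>X. SUP A \<in> ?P X. ennreal (\<nu> A)"
  have nu0: "\<nu> {} = 0"
    using complex_measure_empty[OF \<nu>] by simp
  have ca: "(\<lambda>n. \<nu> (A n)) sums \<nu> (\<Union>n. A n)"
    if "range A \<subseteq> sets M" "disjoint_family A" for A :: "nat \<Rightarrow> 'o set"
    using \<nu>[unfolded complex_measure_def, rule_format, of A] that by (simp only: sums_of_real_iff)
  have add: "\<nu> (A \<union> B) = \<nu> A + \<nu> B"
    if "A \<in> sets M" "B \<in> sets M" "A \<inter> B = {}" for A B
  proof -
    have "(\<lambda>n. \<nu> (binaryset A B n)) sums \<nu> (\<Union>n. binaryset A B n)"
      using that by (intro ca) (auto simp: range_binaryset_eq disjoint_family_on_def binaryset_def)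
    moreover have "(\<lambda>n. \<nu> (binaryset A B n)) sums (\<nu> A + \<nu> B)"
      by (rule binaryset_sums) (rule nu0)
    ultimately show ?thesis
      using sums_unique2 UN_binaryset_eq by metis
  qed
  have V_empty: "?V {} = 0"
  proof -
    have "?P {} = {{}}" by auto
    then show ?thesis by (simp add: nu0)
  qed
  have super: "?V X + ?V Y \<le> ?V (X \<union> Y)"
    if XY: "X \<in> sets M" "Y \<in> sets M" "X \<inter> Y = {}" for X Y
  proof -
    have ne: "?P Z \<noteq> {}" for Z by auto
    have *: "ennreal (\<nu> A) + ennreal (\<nu> B) \<le> ?V (X \<union> Y)" if A: "A \<in> ?P X" and B: "B \<in> ?P Y" for A B
    proof -
      have up: "ennreal (\<nu> C) \<le> ?V (X \<union> Y)" if "C \<in> ?P (X \<union> Y)" for C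
        using that by (rule SUP_upper)
      consider "\<nu> A \<le> 0" | "\<nu> B \<le> 0" | "0 \<le> \<nu> A" "0 \<le> \<nu> B" by linarith
      then show ?thesis
      proof cases
        case 1
        then show ?thesis using up[of B] B by (auto simp: ennreal_neg)
      next
        case 2
        then show ?thesis using up[of A] A by (auto simp: ennreal_neg)
      next
        case 3
        have AB: "A \<in> sets M" "B \<in> sets M" "A \<inter> B = {}" "A \<union> B \<in> ?P (X \<union> Y)"
          using A B XY(3) by blast+
        have "\<nu> (A \<union> B) = \<nu> A + \<nu> B"
          using AB(1-3) by (rule add)
        then have "ennreal (\<nu> A) + ennreal (\<nu> B) = ennreal (\<nu> (A \<union> B))"
          using 3 by (simp only: ennreal_plus)
        also have "\<dots> \<le> ?V (X \<union> Y)"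
          using AB(4) by (rule up)
        finally show ?thesis .
      qed
    qed
    then show ?thesis
      by (rule SUP_add_SUP_le[OF ne ne])
  qed
  have mono: "?V X \<le> ?V Y" if "X \<in> sets M" "Y \<in> sets M" "X \<subseteq> Y" for X Y
    using that by (intro SUP_subset_mono) auto
  have sub: "?V (\<Union>n. A n) \<le> (\<Sum>n. ?V (A n))"
    if A: "range A \<subseteq> sets M" "disjoint_family A" for A :: "nat \<Rightarrow> 'o set"
  proof (rule SUP_least)
    fix B assume B: "B \<in> ?P (\<Union>n. A n)"
    have "(\<Union>n. A n \<inter> B) = B" using B by auto
    moreover have "disjoint_family (\<lambda>n. A n \<inter> B)"
      using A(2) by (auto simp: disjoint_family_on_def)
    ultimately have sums: "(\<lambda>n. \<nu> (A n \<inter> B)) sums \<nu> B"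
      using ca[of "\<lambda>n. A n \<inter> B"] A(1) B by (simp add: image_subset_iff sets.Int)
    show "ennreal (\<nu> B) \<le> (\<Sum>n. ?V (A n))"
    proof (rule LIMSEQ_le_const2)
      show "(\<lambda>N. ennreal (\<Sum>n<N. \<nu> (A n \<inter> B))) \<longlonglongrightarrow> ennreal (\<nu> B)"
        using sums unfolding sums_def by (rule tendsto_ennrealI)
      have "ennreal (\<Sum>n<N. \<nu> (A n \<inter> B)) \<le> (\<Sum>n. ?V (A n))" for N
      proof -
        have "ennreal (\<Sum>n<N. \<nu> (A n \<inter> B)) \<le> ennreal (\<Sum>n<N. max 0 (\<nu> (A n \<inter> B)))"
          by (intro ennreal_leI sum_mono) auto
        also have "\<dots> = (\<Sum>n<N. ennreal (\<nu> (A n \<inter> B)))"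
          by (subst sum_ennreal[symmetric]) (simp_all add: ennreal_max_0 del: sum_ennreal)
        also have "\<dots> \<le> (\<Sum>n<N. ?V (A n))"
          using A(1) B by (intro sum_mono SUP_upper) auto
        also have "\<dots> \<le> (\<Sum>n. ?V (A n))"
          by (intro sum_le_suminf) auto
        finally show ?thesis .
      qed
      then show "\<exists>N. \<forall>n\<ge>N. ennreal (\<Sum>n<n. \<nu> (A n \<inter> B)) \<le> (\<Sum>n. ?V (A n))"
        by blast
    qed
  qed
  show ?thesis
  proof (rule emeasure_measure_of[OF positive_variation_def])
    have [simp]: "sets (positive_variation M \<nu>) = sets M"
      by (simp add: positive_variation_def)
    show "sets M \<subseteq> Pow (space M)"
      by (rule sets.space_closed)
    show "positive (sets (positive_variation M \<nu>)) ?V"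
      unfolding positive_def by (rule V_empty)
    show "countably_additive (sets (positive_variation M \<nu>)) ?V"
      unfolding \<open>sets (positive_variation M \<nu>) = sets M\<close>
    proof (rule countably_additive_sup)
      show "?V {} = 0" by (rule V_empty)
      show "?V X \<le> ?V Y" if "X \<in> sets M" "Y \<in> sets M" "X \<subseteq> Y" for X Y
        using that by (rule mono)
      show "?V X + ?V Y \<le> ?V (X \<union> Y)" if "X \<in> sets M" "Y \<in> sets M" "X \<inter> Y = {}" for X Y
        using that by (rule super)
      show "?V (\<Union>n. A n) \<le> (\<Sum>n::nat. ?V (A n))" if "range A \<subseteq> sets M" "disjoint_family A" for A
        using that by (rule sub)
    qed
    show "X \<in> sets (positive_variation M \<nu>)"
      using X by simp
  qed
qed


section \<open>Positive operator valued measures\<close>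

definition povm :: "'o measure \<Rightarrow> ('o set \<Rightarrow> 'h::chilbert_space \<Rightarrow> 'h) \<Rightarrow> bool"
  where "povm M E \<longleftrightarrow>
    (\<forall>X\<in>sets M. positive_operator (E X)) \<and>
    (\<forall>A \<phi>. range A \<subseteq> sets M \<and> disjoint_family A \<longrightarrow>
      (\<lambda>n::nat. E (A n) \<phi>) sums E (\<Union>n. A n) \<phi>)"

definition projection_valued :: "'o measure \<Rightarrow> ('o set \<Rightarrow> 'h::chilbert_space \<Rightarrow> 'h) \<Rightarrow> bool"
  where "projection_valued M E \<longleftrightarrow> (\<forall>X\<in>sets M. orthogonal_projection (E X))"

definition povm_cm :: "('o set \<Rightarrow> 'h::chilbert_space \<Rightarrow> 'h) \<Rightarrow> 'h \<Rightarrow> 'h \<Rightarrow> 'o set \<Rightarrow> complex"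
  where "povm_cm E \<psi> \<phi> X = cinner \<psi> (E X \<phi>)"

text \<open>The diagonal \<open>povm_cm E \<phi> \<phi>\<close> as a positive measure.\<close>

definition povm_diag :: "'o measure \<Rightarrow> ('o set \<Rightarrow> 'h::chilbert_space \<Rightarrow> 'h) \<Rightarrow> 'h \<Rightarrow> 'o measure"
  where "povm_diag M E \<phi> =
    measure_of (space M) (sets M) (\<lambda>X. ennreal (Re (povm_cm E \<phi> \<phi> X)))"

lemma tendsto_cinner_right:
  fixes x :: "'h::chilbert_space"
  assumes "(u \<longlongrightarrow> y) F"
  shows "((\<lambda>n. cinner x (u n)) \<longlongrightarrow> cinner x y) F"
proof -
  have add_left: "cinner (x + y) z = cinner x z + cinner y z" for x y z :: 'h
    by (metis cinner_commute cinner_add_right complex_cnj_add)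
  have Re: "Re (cinner x y) = ((norm (x + y))\<^sup>2 - (norm x)\<^sup>2 - (norm y)\<^sup>2) / 2" for x y :: 'h
  proof -
    have "of_real ((norm (x + y))\<^sup>2) =
        cinner x x + cinner y y + cinner x y + cinner y x"
      by (simp add: cinner_self[symmetric] cinner_add_right add_left del: of_real_power)
    moreover have "Re (cinner y x) = Re (cinner x y)"
      using arg_cong[OF cinner_commute[of y x], of Re] by simp
    ultimately show ?thesis
      by (simp add: cinner_self complex_eq_iff)
  qed
  have "Re (cinner (\<i> *\<^sub>C x) y) = Im (cinner x y)" for y
  proof -
    have "cinner (\<i> *\<^sub>C x) y = - \<i> * cinner x y"
      by (metis cinner_commute cinner_scaleC_right complex_cnj_mult complex_cnj_i)
    then show ?thesis by simp
  qed
  then have "Im (cinner x y) =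
      ((norm (\<i> *\<^sub>C x + y))\<^sup>2 - (norm (\<i> *\<^sub>C x))\<^sup>2 - (norm y)\<^sup>2) / 2" for y
    using Re by metis
  then show ?thesis
    unfolding tendsto_complex_iff Re by (simp only:) (intro conjI tendsto_intros assms; simp)
qed

lemma complex_measure_povm_cm:
  assumes "povm M E"
  shows "complex_measure M (povm_cm E \<psi> \<phi>)"
  unfolding complex_measure_def
proof (intro allI impI)
  fix A :: "nat \<Rightarrow> _"
  assume A: "range A \<subseteq> sets M \<and> disjoint_family A"
  have sum: "cinner \<psi> (sum u S) = (\<Sum>n\<in>S. cinner \<psi> (u n))" for u and S :: "nat set"
  proof -
    have "cinner \<psi> 0 = 0"
      using cinner_add_right[of \<psi> 0 0] by simp
    then show ?thesis
      by (induction S rule: infinite_finite_induct) (simp_all add: cinner_add_right)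
  qed
  have "(\<lambda>n. E (A n) \<phi>) sums E (\<Union>n. A n) \<phi>"
    using assms A unfolding povm_def by blast
  then show "(\<lambda>n. povm_cm E \<psi> \<phi> (A n)) sums povm_cm E \<psi> \<phi> (\<Union>n. A n)"
    unfolding sums_def povm_cm_def sum[symmetric] by (rule tendsto_cinner_right)
qed

lemma emeasure_povm_diag:
  assumes E: "povm M E" and X: "X \<in> sets M"
  shows "emeasure (povm_diag M E \<phi>) X = ennreal (Re (povm_cm E \<phi> \<phi> X))"
proof (rule emeasure_measure_of[OF povm_diag_def])
  note cm = complex_measure_povm_cm[OF E, of \<phi> \<phi>]
  have nonneg: "0 \<le> Re (povm_cm E \<phi> \<phi> Y)" if "Y \<in> sets M" for Y
    using E that by (auto simp: povm_def positive_operator_def povm_cm_def complex_nonneg_Reals_iff)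
  show "positive (sets (povm_diag M E \<phi>)) (\<lambda>X. ennreal (Re (povm_cm E \<phi> \<phi> X)))"
    by (simp add: positive_def complex_measure_empty[OF cm])
  show "countably_additive (sets (povm_diag M E \<phi>)) (\<lambda>X. ennreal (Re (povm_cm E \<phi> \<phi> X)))"
  proof (rule countably_additiveI)
    fix A :: "nat \<Rightarrow> _"
    assume "range A \<subseteq> sets (povm_diag M E \<phi>)" and d: "disjoint_family A"
    then have A: "range A \<subseteq> sets M"
      by (simp add: povm_diag_def)
    with d have "(\<lambda>n. povm_cm E \<phi> \<phi> (A n)) sums povm_cm E \<phi> \<phi> (\<Union>n. A n)"
      using cm unfolding complex_measure_def by simp
    then have "(\<lambda>n. Re (povm_cm E \<phi> \<phi> (A n))) sums Re (povm_cm E \<phi> \<phi> (\<Union>n. A n))"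
      by (rule sums_Re)
    with A show "(\<Sum>n. ennreal (Re (povm_cm E \<phi> \<phi> (A n)))) = ennreal (Re (povm_cm E \<phi> \<phi> (\<Union>n. A n)))"
      by (intro suminf_ennreal_eq nonneg) auto
  qed
qed (simp_all add: X povm_diag_def sets.space_closed sets_measure_of)


section \<open>Operator integrals\<close>

text \<open>
  A linear operator defined on a subspace is modelled as a partial function, so that
  equality comprises equality of the domains. In all cases below the vector \<open>\<eta>\<close> is
  unique, for the strong integral by nondegeneracy of the inner product and for the weak one
  when \<open>form_domain M E f\<close> is dense.
\<close>

definition strong_domain ::
    "'o measure \<Rightarrow> ('o set \<Rightarrow> 'h::chilbert_space \<Rightarrow> 'h) \<Rightarrow> ('o \<Rightarrow> complex) \<Rightarrow> 'h set"
  where "strong_domain M E f =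
    {\<phi>. \<forall>\<psi>. (\<integral>\<^sup>+ x. ennreal (cmod (f x)) \<partial>total_variation M (povm_cm E \<psi> \<phi>)) < \<infinity>}"

definition strong_integral ::
    "'o measure \<Rightarrow> ('o set \<Rightarrow> 'h::chilbert_space \<Rightarrow> 'h) \<Rightarrow> ('o \<Rightarrow> complex) \<Rightarrow> 'h \<rightharpoonup> 'h"
  where "strong_integral M E f = (\<lambda>\<phi>.
    if \<phi> \<in> strong_domain M E f
    then Some (THE \<eta>. \<forall>\<psi>. cinner \<psi> \<eta> = cm_integral M (povm_cm E \<psi> \<phi>) f)
    else None)"

definition square_domain ::
    "'o measure \<Rightarrow> ('o set \<Rightarrow> 'h::chilbert_space \<Rightarrow> 'h) \<Rightarrow> ('o \<Rightarrow> complex) \<Rightarrow> 'h set"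
  where "square_domain M E f =
    {\<phi>. (\<integral>\<^sup>+ x. ennreal ((cmod (f x))\<^sup>2) \<partial>povm_diag M E \<phi>) < \<infinity>}"

definition square_integral ::
    "'o measure \<Rightarrow> ('o set \<Rightarrow> 'h::chilbert_space \<Rightarrow> 'h) \<Rightarrow> ('o \<Rightarrow> complex) \<Rightarrow> 'h \<rightharpoonup> 'h"
  where "square_integral M E f = strong_integral M E f |` square_domain M E f"

definition form_domain ::
    "'o measure \<Rightarrow> ('o set \<Rightarrow> 'h::chilbert_space \<Rightarrow> 'h) \<Rightarrow> ('o \<Rightarrow> complex) \<Rightarrow> 'h set"
  where "form_domain M E f =
    {\<phi>. (\<integral>\<^sup>+ x. ennreal (cmod (f x)) \<partial>povm_diag M E \<phi>) < \<infinity>}"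

definition weak_domain ::
    "'o measure \<Rightarrow> ('o set \<Rightarrow> 'h::chilbert_space \<Rightarrow> 'h) \<Rightarrow> ('o \<Rightarrow> complex) \<Rightarrow> 'h set"
  where "weak_domain M E f =
    {\<phi> \<in> form_domain M E f.
      continuous_on (form_domain M E f) (\<lambda>\<psi>. cm_integral M (povm_cm E \<psi> \<phi>) f)}"

definition weak_integral ::
    "'o measure \<Rightarrow> ('o set \<Rightarrow> 'h::chilbert_space \<Rightarrow> 'h) \<Rightarrow> ('o \<Rightarrow> complex) \<Rightarrow> 'h \<rightharpoonup> 'h"
  where "weak_integral M E f = (\<lambda>\<phi>.
    if \<phi> \<in> weak_domain M E f
    then Some (THE \<eta>. \<forall>\<psi>\<in>form_domain M E f. cinner \<psi> \<eta> = cm_integral M (povm_cm E \<psi> \<phi>) f)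
    else None)"

end

theory Submission
  imports Defs
begin

text \<open>
  Write \<open>\<mu>\<^sub>\<phi>\<close> for the measure \<open>X \<mapsto> \<langle>\<phi>|E(X)\<phi>\<rangle>\<close>. A projection valued measure is multiplicative,
  \<open>E(X) E(Y) = E(X \<inter> Y)\<close>, so for a simple function \<open>s\<close> the operator \<open>T(s) = \<Sum> y E(s = y)\<close> satisfies
  \<open>\<langle>T(g)\<phi>|T(s)\<phi>\<rangle> = \<integral> cnj g * s d\<mu>\<^sub>\<phi>\<close>. In particular the squared norm of \<open>T(s)\<phi>\<close> is the integral of
  \<open>\<bar>s\<bar>\<^sup>2\<close>. Fix simple functions \<open>s\<^sub>n \<longlonglongrightarrow> f\<close> with \<open>\<bar>s\<^sub>n - f\<bar> \<le> \<bar>f\<bar>\<close>. By Fatou's lemma in one direction and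
  \<open>\<bar>s\<^sub>n\<bar> \<le> 2 \<bar>f\<bar>\<close> in the other, \<open>\<phi>\<close> lies in the square integrability domain exactly when the
  vectors \<open>T(s\<^sub>n)\<phi>\<close> are bounded in norm, and \<open>\<integral> f dE\<^sub>\<psi>\<^sub>\<phi>\<close> is the limit of \<open>\<langle>\<psi>|T(s\<^sub>n)\<phi>\<rangle>\<close> whenever \<open>f\<close> is
  integrable (\<open>cm_integral_tendsto\<close>). The three domains are compared through this criterion.

  If \<open>\<phi>\<close> is in the square domain, then \<open>f\<close> is integrable for every \<open>E\<^sub>\<psi>\<^sub>\<phi>\<close>, because the
  Cauchy--Schwarz inequality on the cells of a partition bounds the total variation
  (\<open>total_variation_povm_le\<close>), and the integral is Lipschitz in \<open>\<psi>\<close>. So \<open>\<phi>\<close> is in the strong and in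
  the weak domain. If \<open>\<phi>\<close> is in the strong domain, then the \<open>T(s\<^sub>n)\<phi>\<close> converge weakly, and the uniform
  boundedness principle (\<open>weakly_bounded_imp_bounded\<close>) bounds their norms. If \<open>\<phi>\<close> is in the weak
  domain, then evaluating the continuous functional at \<open>T(s\<^sub>n)\<phi>\<close> itself gives a number that
  dominates half of the squared norm of \<open>T(s\<^sub>n)\<phi>\<close>, and the norms are bounded again.

  Finally the form domain is dense (\<open>form_domain_dense\<close>), so a vector that represents
  \<open>\<psi> \<mapsto> \<integral> f dE\<^sub>\<psi>\<^sub>\<phi>\<close> there represents it everywhere, and the strong and the weak integral have the
  same values.
\<close>

section \<open>The inner product\<close>

lemma cinner_add_left: "cinner (x + y) (z::'h::chilbert_space) = cinner x z + cinner y z"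
  by (metis cinner_commute cinner_add_right complex_cnj_add)

lemma cinner_scaleC_left: "cinner (c *\<^sub>C x) (y::'h::chilbert_space) = cnj c * cinner x y"
  by (metis cinner_commute cinner_scaleC_right complex_cnj_mult)

lemma cinner_zero_right [simp]: "cinner x (0::'h::chilbert_space) = 0"
  using cinner_add_right[of x 0 0] by simp

lemma cinner_zero_left [simp]: "cinner (0::'h::chilbert_space) x = 0"
  using cinner_add_left[of 0 0 x] by simp

lemma cinner_diff_left: "cinner (x - y) z = cinner x z - cinner y (z::'h::chilbert_space)"
  using cinner_add_left[of "x - y" y z] by simp

lemma cinner_sum_right: "cinner x (sum u S) = (\<Sum>i\<in>S. cinner x (u i :: 'h::chilbert_space))"
  by (induction S rule: infinite_finite_induct) (simp_all add: cinner_add_right)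

lemma cinner_sum_left: "cinner (sum u S) x = (\<Sum>i\<in>S. cinner (u i :: 'h::chilbert_space) x)"
  by (induction S rule: infinite_finite_induct) (simp_all add: cinner_add_left)

lemma norm_scaleC: "norm (c *\<^sub>C (x::'h::chilbert_space)) = cmod c * norm x"
proof -
  have "cinner (c *\<^sub>C x) (c *\<^sub>C x) = of_real ((cmod c * norm x)\<^sup>2)"
    unfolding cinner_scaleC_left cinner_scaleC_right
    unfolding cinner_self power_mult_distrib of_real_mult complex_norm_square
    by (simp add: ac_simps)
  then have "(norm (c *\<^sub>C x))\<^sup>2 = (cmod c * norm x)\<^sup>2"
    by (simp only: cinner_self of_real_eq_iff)
  then show ?thesis
    by (simp add: power2_eq_iff_nonneg)
qed

text \<open>The triangle inequality bounds the real part of the inner product; rotating one argument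
  by a phase makes the inner product real and nonnegative.\<close>

lemma cinner_Cauchy_Schwarz: "cmod (cinner x y) \<le> norm x * norm (y::'h::chilbert_space)"
proof -
  have Re_le: "Re (cinner x z) \<le> norm x * norm z" for z
  proof -
    have "of_real ((norm (x + z))\<^sup>2) = cinner x x + cinner z z + cinner x z + cinner z x"
      by (simp add: cinner_self[symmetric] cinner_add_right cinner_add_left del: of_real_power)
    moreover have "Re (cinner z x) = Re (cinner x z)"
      using arg_cong[OF cinner_commute[of z x], of Re] by simp
    ultimately have "(norm (x + z))\<^sup>2 = (norm x)\<^sup>2 + (norm z)\<^sup>2 + 2 * Re (cinner x z)"
      by (simp add: cinner_self complex_eq_iff)
    moreover have "(norm (x + z))\<^sup>2 \<le> (norm x + norm z)\<^sup>2"
      by (intro power_mono norm_triangle_ineq) simp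
    ultimately show ?thesis
      by (simp add: power2_eq_square algebra_simps)
  qed
  define u where "u = (if cinner x y = 0 then 1 else cnj (sgn (cinner x y)))"
  have "cmod u = 1"
    by (simp add: u_def norm_sgn)
  moreover have "u * cinner x y = of_real (cmod (cinner x y))"
    using complex_norm_square[of "cinner x y"]
    by (auto simp: u_def sgn_eq power2_eq_square mult.commute[of "cnj _"] nonzero_divide_eq_eq)
  ultimately show ?thesis
    using Re_le[of "u *\<^sub>C y"] by (simp add: cinner_scaleC_right norm_scaleC)
qed

text \<open>This is the uniform boundedness principle for the functionals \<open>\<psi> \<mapsto> cinner \<psi> (u n)\<close>:
  by Baire's theorem one of the closed sets on which all of them are bounded by \<open>k\<close> contains
  a ball.\<close>

lemma weakly_bounded_imp_bounded:
  fixes u :: "nat \<Rightarrow> 'h::chilbert_space"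
  assumes bdd: "\<And>\<psi>. \<exists>C. \<forall>n. cmod (cinner \<psi> (u n)) \<le> C"
  shows "\<exists>C. \<forall>n. norm (u n) \<le> C"
proof -
  define A where "A k = {\<psi>. \<forall>n. cmod (cinner \<psi> (u n)) \<le> real k}" for k
  have cont: "continuous_on UNIV (\<lambda>\<psi>. cmod (cinner \<psi> (u n)))" for n
  proof -
    have "cmod (cinner \<psi> (u n)) = cmod (cinner (u n) \<psi>)" for \<psi>
      by (metis cinner_commute complex_mod_cnj)
    then show ?thesis
      by (auto simp: continuous_on_def intro!: tendsto_norm tendsto_cinner_right)
  qed
  have closed: "closed (A k)" for k
  proof -
    have "A k = (\<Inter>n. {\<psi>. cmod (cinner \<psi> (u n)) \<le> real k})"
      by (auto simp: A_def)
    then show ?thesis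
      using cont by (auto intro!: closed_INT closed_Collect_le continuous_on_const)
  qed
  have "(\<Union>k. A k) = UNIV"
  proof -
    have "\<exists>k. \<psi> \<in> A k" for \<psi>
    proof -
      obtain C where "\<forall>n. cmod (cinner \<psi> (u n)) \<le> C"
        using bdd by blast
      moreover obtain k where "C \<le> real k"
        using real_arch_simple by blast
      ultimately show ?thesis
        by (auto simp: A_def intro: order_trans)
    qed
    then show ?thesis by auto
  qed
  then have "\<exists>k. interior (A k) \<noteq> {}"
    using Met_TC.metric_Baire_category_alt[of "range A"] closed
    by (auto simp: complete_UNIV interior_of_def interior_def)
  then obtain k x r where r: "r > 0" "cball x r \<subseteq> A k"
    by (metis ex_in_conv mem_interior_cball)
  have "norm (u n) \<le> 2 * real k / r" for n
  proof (cases "u n = 0")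
    case False
    define v where "v = of_real (r / norm (u n)) *\<^sub>C u n"
    have "norm v = r"
      using False r(1) by (simp add: v_def norm_scaleC norm_divide del: of_real_divide)
    then have "x + v \<in> A k" "x \<in> A k"
      using r by (auto simp: subset_iff dist_norm)
    then have "cmod (cinner (x + v) (u n)) \<le> real k" "cmod (cinner x (u n)) \<le> real k"
      by (auto simp: A_def)
    then have "cmod (cinner v (u n)) \<le> 2 * real k"
      using norm_triangle_ineq4[of "cinner (x + v) (u n)" "cinner x (u n)"]
      by (simp add: cinner_add_left)
    moreover have "cmod (cinner v (u n)) = r * norm (u n)"
      using False r(1)
      by (simp add: v_def cinner_scaleC_left cinner_self norm_mult norm_divide norm_power power2_eq_square)
    ultimately show ?thesis
      using r(1) by (simp add: field_simps)
  qed (use r in simp)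
  then show ?thesis by blast
qed

section \<open>Comparing integrals through level sets\<close>

lemma sets_level_set: "simple_function M s \<Longrightarrow> {x \<in> space M. s x = y} \<in> sets M"
  using simple_functionD(2)[of M s "{y}"] by (simp add: vimage_def Int_def conj_commute)

text \<open>A Lebesgue integral is a supremum over simple functions \<open>g\<close>, each of which only involves
  the measures of the sets on which \<open>g\<close> is a constant \<open>t\<close>. The hypothesis is needed for each
  \<open>t\<close> separately, so its right-hand side may depend on \<open>t\<close> in a nonlinear way.\<close>

lemma nn_integral_le_of_level:
  fixes u v :: "ennreal \<Rightarrow> ennreal"
  assumes sets: "sets P = sets N" "sets Q = sets N"
    and mono: "mono u" "mono v"
    and le: "\<And>X t. X \<in> sets N \<Longrightarrow> t < \<infinity> \<Longrightarrow>
      t * emeasure N X \<le> u t * emeasure P X + v t * emeasure Q X"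
  shows "(\<integral>\<^sup>+ x. h x \<partial>N) \<le> (\<integral>\<^sup>+ x. u (h x) \<partial>P) + (\<integral>\<^sup>+ x. v (h x) \<partial>Q)"
  unfolding nn_integral_def_finite[of N h]
proof (rule SUP_least)
  fix g assume "g \<in> {g. simple_function N g \<and> g \<le> h \<and> (\<forall>x. g x < top)}"
  then have g: "simple_function N g" "\<And>x. g x \<le> h x" "\<And>x. g x < \<infinity>"
    by (auto simp: le_fun_def infinity_ennreal_def)
  have space: "space P = space N" "space Q = space N"
    using sets by (auto dest: sets_eq_imp_space_eq)
  have simple: "simple_function P g" "simple_function Q g"
    using g(1) sets space by (simp_all add: simple_function_def)
  have "integral\<^sup>S N g = (\<Sum>y\<in>g ` space N. y * emeasure N {x \<in> space N. g x = y})"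
    by (rule simple_function_partition[OF g(1) g(1)]) auto
  also have "\<dots> \<le> (\<Sum>y\<in>g ` space N. u y * emeasure P {x \<in> space N. g x = y}
      + v y * emeasure Q {x \<in> space N. g x = y})"
    using g(3) by (intro sum_mono le sets_level_set g(1)) auto
  also have "\<dots> = (\<Sum>y\<in>g ` space P. u y * emeasure P {x \<in> space P. g x = y})
      + (\<Sum>y\<in>g ` space Q. v y * emeasure Q {x \<in> space Q. g x = y})"
    by (simp add: sum.distrib space)
  also have "(\<Sum>y\<in>g ` space P. u y * emeasure P {x \<in> space P. g x = y}) = integral\<^sup>S P (\<lambda>x. u (g x))"
    by (rule simple_function_partition[OF simple_function_compose1[OF simple(1)] simple(1), symmetric])
      auto
  also have "\<dots> = (\<integral>\<^sup>+ x. u (g x) \<partial>P)"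
    by (rule nn_integral_eq_simple_integral[OF simple_function_compose1[OF simple(1)], symmetric])
  also have "\<dots> \<le> (\<integral>\<^sup>+ x. u (h x) \<partial>P)"
    by (intro nn_integral_mono monoD[OF mono(1)] g)
  also have "(\<Sum>y\<in>g ` space Q. v y * emeasure Q {x \<in> space Q. g x = y}) = integral\<^sup>S Q (\<lambda>x. v (g x))"
    by (rule simple_function_partition[OF simple_function_compose1[OF simple(2)] simple(2), symmetric])
      auto
  also have "\<dots> = (\<integral>\<^sup>+ x. v (g x) \<partial>Q)"
    by (rule nn_integral_eq_simple_integral[OF simple_function_compose1[OF simple(2)], symmetric])
  also have "\<dots> \<le> (\<integral>\<^sup>+ x. v (h x) \<partial>Q)"
    by (intro nn_integral_mono monoD[OF mono(2)] g)
  finally show "integral\<^sup>S N g \<le> (\<integral>\<^sup>+ x. u (h x) \<partial>P) + (\<integral>\<^sup>+ x. v (h x) \<partial>Q)"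
    by (simp add: add_mono)
qed

lemma simple_function_integral:
  fixes s :: "'o \<Rightarrow> 'b::{banach, second_countable_topology}"
  assumes "finite_measure N" and sets: "sets N = sets M" and s: "simple_function M s"
  shows "integrable N s"
    and "integral\<^sup>L N s = (\<Sum>y\<in>s ` space M. measure N {x \<in> space M. s x = y} *\<^sub>R y)"
proof -
  interpret finite_measure N by fact
  have space: "space N = space M"
    using sets by (rule sets_eq_imp_space_eq)
  have "simple_function N s"
    using s sets space by (simp add: simple_function_def)
  then have "Bochner_Integration.simple_bochner_integrable N s"
    by (simp add: Bochner_Integration.simple_bochner_integrable.simps)
  then have "has_bochner_integral N s (Bochner_Integration.simple_bochner_integral N s)"
    by (rule Bochner_Integration.has_bochner_integral_simple_bochner_integrable)
  then show "integrable N s"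
    and "integral\<^sup>L N s = (\<Sum>y\<in>s ` space M. measure N {x \<in> space M. s x = y} *\<^sub>R y)"
    by (auto simp: has_bochner_integral_iff Bochner_Integration.simple_bochner_integral_def space)
qed

text \<open>Approximants within distance \<open>\<bar>f\<bar>\<close> of \<open>f\<close> satisfy \<open>\<bar>g\<bar>\<^sup>2 \<le> 2 Re (cnj g * f)\<close>, so that
  testing against \<open>g\<close> controls the square integral of \<open>g\<close>.\<close>

lemma simple_functions_close_to:
  fixes f :: "'o \<Rightarrow> complex"
  assumes "f \<in> borel_measurable M"
  obtains s where "\<And>n::nat. simple_function M (s n)"
    and "\<And>x. x \<in> space M \<Longrightarrow> (\<lambda>n. s n x) \<longlonglongrightarrow> f x"
    and "\<And>n x. x \<in> space M \<Longrightarrow> cmod (s n x - f x) \<le> cmod (f x)"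
proof -
  obtain F where F: "\<And>n::nat. simple_function M (F n)" "\<And>x. x \<in> space M \<Longrightarrow> (\<lambda>n. F n x) \<longlonglongrightarrow> f x"
    using borel_measurable_implies_sequence_metric[OF assms, of 0] by blast
  define s where "s n x = (if cmod (F n x - f x) \<le> cmod (f x) then F n x else 0)" for n x
  have [measurable]: "f \<in> borel_measurable M" "F n \<in> borel_measurable M" for n
    using assms F(1) by (auto intro: borel_measurable_simple_function)
  have "simple_function M (s n)" for n
    unfolding s_def by (intro simple_function_If F(1) simple_function_const) measurable
  moreover have "(\<lambda>n. s n x) \<longlonglongrightarrow> f x" if x: "x \<in> space M" for x
  proof (cases "f x = 0")
    case True
    then have "s n x = f x" for n by (simp add: s_def)
    then show ?thesis by simp
  next
    case False
    have "(\<lambda>n. cmod (F n x - f x)) \<longlonglongrightarrow> 0"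
      using F(2)[OF x] by (simp add: LIM_zero tendsto_norm_zero)
    then have "\<forall>\<^sub>F n in sequentially. cmod (F n x - f x) < cmod (f x)"
      using False by (intro order_tendstoD) auto
    then have "\<forall>\<^sub>F n in sequentially. F n x = s n x"
      by eventually_elim (auto simp: s_def)
    with F(2)[OF x] show ?thesis
      by (rule Lim_transform_eventually)
  qed
  moreover have "cmod (s n x - f x) \<le> cmod (f x)" for n x
    by (simp add: s_def)
  ultimately show ?thesis
    using that by blast
qed

section \<open>Integrals with respect to a complex measure\<close>

lemma sets_positive_variation [simp]: "sets (positive_variation M \<nu>) = sets M"
  by (simp add: positive_variation_def)

lemma sets_total_variation [simp]: "sets (total_variation M \<mu>) = sets M"
  by (simp add: total_variation_def)

lemma cmod_le_total_variation:
  assumes "complex_measure M \<mu>" and X: "X \<in> sets M"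
  shows "ennreal (cmod (\<mu> X)) \<le> emeasure (total_variation M \<mu>) X"
proof (cases "X = {}")
  case True
  then show ?thesis by (simp add: complex_measure_empty[OF assms(1)])
next
  case False
  then have "{X} \<in> {P. finite P \<and> P \<subseteq> sets M \<and> partition_on X P}"
    using X by (auto intro: partition_on_space)
  from SUP_upper[OF this, of "\<lambda>P. \<Sum>A\<in>P. ennreal (cmod (\<mu> A))"]
  show ?thesis
    by (simp add: emeasure_total_variation[OF assms])
qed

lemma positive_variation_le_total_variation:
  assumes \<mu>: "complex_measure M \<mu>" and \<nu>: "complex_measure M (\<lambda>X. of_real (\<nu> X))"
    and le: "\<And>X. X \<in> sets M \<Longrightarrow> \<nu> X \<le> cmod (\<mu> X)"
  shows "positive_variation M \<nu> \<le> total_variation M \<mu>"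
proof (subst le_measure; (intro ballI)?)
  fix X assume "X \<in> sets (positive_variation M \<nu>)"
  then have X: "X \<in> sets M" by simp
  show "emeasure (positive_variation M \<nu>) X \<le> emeasure (total_variation M \<mu>) X"
    unfolding emeasure_positive_variation[OF \<nu> X]
  proof (rule SUP_least)
    fix A assume A: "A \<in> {A \<in> sets M. A \<subseteq> X}"
    have "ennreal (\<nu> A) \<le> ennreal (cmod (\<mu> A))"
      using A by (intro ennreal_leI le) auto
    also have "\<dots> \<le> emeasure (total_variation M \<mu>) A"
      using A by (intro cmod_le_total_variation \<mu>) auto
    also have "\<dots> \<le> emeasure (total_variation M \<mu>) X"
      using A X by (intro emeasure_mono) auto
    finally show "ennreal (\<nu> A) \<le> emeasure (total_variation M \<mu>) X" .
  qed
qed simp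

text \<open>Since \<open>\<nu> A = \<nu> X - \<nu> (X - A)\<close>, the suprema over \<open>A \<subseteq> X\<close> that define the two variations
  differ by \<open>\<nu> X\<close>.\<close>

lemma Jordan_decomposition:
  fixes \<nu> :: "'o set \<Rightarrow> real"
  assumes \<nu>: "complex_measure M (\<lambda>X. of_real (\<nu> X))"
    and fin: "finite_measure (positive_variation M \<nu>)"
      "finite_measure (positive_variation M (\<lambda>X. - \<nu> X))"
    and X: "X \<in> sets M"
  shows "measure (positive_variation M \<nu>) X - measure (positive_variation M (\<lambda>X. - \<nu> X)) X = \<nu> X"
proof -
  have *: "measure (positive_variation M (\<lambda>X. - \<nu> X)) X \<le> measure (positive_variation M \<nu>) X - \<nu> X"
    if \<nu>: "complex_measure M (\<lambda>X. of_real (\<nu> X))"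
      and \<nu>': "complex_measure M (\<lambda>X. of_real (- \<nu> X))"
      and "finite_measure (positive_variation M \<nu>)" for \<nu> :: "'o set \<Rightarrow> real"
  proof -
    interpret finite_measure "positive_variation M \<nu>" by fact
    have up: "\<nu> A \<le> measure (positive_variation M \<nu>) X" if "A \<in> sets M" "A \<subseteq> X" for A
    proof -
      have "ennreal (\<nu> A) \<le> ennreal (measure (positive_variation M \<nu>) X)"
        unfolding emeasure_eq_measure[symmetric] emeasure_positive_variation[OF \<nu> X]
        using that by (intro SUP_upper) auto
      then show ?thesis by (simp add: ennreal_le_iff)
    qed
    have "emeasure (positive_variation M (\<lambda>X. - \<nu> X)) X \<le> ennreal (measure (positive_variation M \<nu>) X - \<nu> X)"
      unfolding emeasure_positive_variation[OF \<nu>' X]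
    proof (intro SUP_least ennreal_leI)
      fix A assume "A \<in> {A \<in> sets M. A \<subseteq> X}"
      then have A: "A \<in> sets M" "A \<subseteq> X" by auto
      have "(\<lambda>n. complex_of_real (\<nu> (binaryset A (X - A) n))) sums of_real (\<nu> (\<Union>n. binaryset A (X - A) n))"
        using A X by (intro \<nu>[unfolded complex_measure_def, rule_format])
          (auto simp: range_binaryset_eq disjoint_family_on_def binaryset_def)
      moreover have "(\<lambda>n. complex_of_real (\<nu> (binaryset A (X - A) n))) sums (of_real (\<nu> A) + of_real (\<nu> (X - A)))"
        by (rule binaryset_sums) (rule complex_measure_empty[OF \<nu>])
      ultimately have "complex_of_real (\<nu> (\<Union>n. binaryset A (X - A) n)) = of_real (\<nu> A + \<nu> (X - A))"
        unfolding of_real_add by (rule sums_unique2)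
      moreover have "(\<Union>n. binaryset A (X - A) n) = X"
        using A by (auto simp: UN_binaryset_eq)
      ultimately have "\<nu> X = \<nu> A + \<nu> (X - A)"
        by (simp only: of_real_eq_iff)
      with up[of "X - A"] A X show "- \<nu> A \<le> measure (positive_variation M \<nu>) X - \<nu> X"
        by auto
    qed
    moreover have "0 \<le> measure (positive_variation M \<nu>) X - \<nu> X"
      using up[OF X] by simp
    ultimately show ?thesis
      by (simp add: measure_def enn2real_leI)
  qed
  have \<nu>': "complex_measure M (\<lambda>X. of_real (- \<nu> X))"
    using \<nu> by (auto simp: complex_measure_def sums_minus)
  show ?thesis
    using *[OF \<nu> \<nu>' fin(1)] *[OF \<nu>' _ fin(2)] \<nu> by simp
qed

lemma finite_positive_variation:
  assumes "positive_variation M \<nu> \<le> total_variation M \<mu>"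
    and "emeasure (total_variation M \<mu>) (space M) < \<infinity>"
  shows "finite_measure (positive_variation M \<nu>)"
proof (rule finite_measureI)
  have "emeasure (positive_variation M \<nu>) (space M) \<le> emeasure (total_variation M \<mu>) (space M)"
    using assms(1) by (simp add: le_measure)
  then show "emeasure (positive_variation M \<nu>) (space (positive_variation M \<nu>)) \<noteq> \<infinity>"
    using assms(2) sets_eq_imp_space_eq[OF sets_positive_variation[of M \<nu>]] by (auto simp: top_unique)
qed

lemma positive_variation_integral_tendsto:
  fixes f :: "'o \<Rightarrow> complex" and \<nu> :: "'o set \<Rightarrow> real"
  assumes le: "positive_variation M \<nu> \<le> total_variation M \<mu>"
    and fin: "emeasure (total_variation M \<mu>) (space M) < \<infinity>"
    and f: "f \<in> borel_measurable M" "(\<integral>\<^sup>+ x. ennreal (cmod (f x)) \<partial>total_variation M \<mu>) < \<infinity>"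
    and s: "\<And>n::nat. simple_function M (s n)" "\<And>x. x \<in> space M \<Longrightarrow> (\<lambda>n. s n x) \<longlonglongrightarrow> f x"
      "\<And>n x. x \<in> space M \<Longrightarrow> cmod (s n x - f x) \<le> cmod (f x)"
  shows "(\<lambda>n. \<Sum>y\<in>s n ` space M. y * of_real (measure (positive_variation M \<nu>) {x \<in> space M. s n x = y}))
      \<longlonglongrightarrow> integral\<^sup>L (positive_variation M \<nu>) f"
proof -
  let ?V = "positive_variation M \<nu>"
  have space: "space ?V = space M"
    by (rule sets_eq_imp_space_eq) simp
  have fm: "finite_measure ?V"
    using le fin by (rule finite_positive_variation)
  have "(\<integral>\<^sup>+ x. ennreal (cmod (f x)) \<partial>?V) < \<infinity>"
    using nn_integral_mono_measure[OF _ le, of "\<lambda>x. ennreal (cmod (f x))"] f(2) by auto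
  moreover have measurable: "borel_measurable ?V = borel_measurable M"
    by (rule measurable_cong_sets) auto
  ultimately have f_int: "integrable ?V f"
    using f(1) by (intro integrableI_bounded) auto
  have "(\<lambda>n. integral\<^sup>L ?V (s n)) \<longlonglongrightarrow> integral\<^sup>L ?V f"
  proof (rule integral_dominated_convergence)
    show "integrable ?V (\<lambda>x. 2 * cmod (f x))"
      using f_int by auto
    have "cmod (s n x) \<le> 2 * cmod (f x)" if "x \<in> space M" for n x
      using s(3)[OF that, of n] norm_triangle_ineq2[of "s n x" "f x"] by simp
    then show "AE x in ?V. cmod (s n x) \<le> 2 * cmod (f x)" for n
      by (intro AE_I2) (simp add: space)
    show "AE x in ?V. (\<lambda>n. s n x) \<longlonglongrightarrow> f x"
      using s(2) by (intro AE_I2) (simp add: space)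
  qed (use f(1) s(1) measurable in \<open>auto intro: borel_measurable_simple_function\<close>)
  then show "(\<lambda>n. \<Sum>y\<in>s n ` space M. y * of_real (measure ?V {x \<in> space M. s n x = y}))
      \<longlonglongrightarrow> integral\<^sup>L ?V f"
    by (simp add: simple_function_integral(2)[OF fm _ s(1)] scaleR_conv_of_real mult.commute)
qed

text \<open>This is how all properties of the integral are obtained below: on simple functions it is a
  finite sum of values of the complex measure, whatever decomposition is used to define it.\<close>

lemma cm_integral_tendsto:
  fixes f :: "'o \<Rightarrow> complex"
  assumes \<mu>: "complex_measure M \<mu>"
    and fin: "emeasure (total_variation M \<mu>) (space M) < \<infinity>"
    and f: "f \<in> borel_measurable M" "(\<integral>\<^sup>+ x. ennreal (cmod (f x)) \<partial>total_variation M \<mu>) < \<infinity>"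
    and s: "\<And>n::nat. simple_function M (s n)" "\<And>x. x \<in> space M \<Longrightarrow> (\<lambda>n. s n x) \<longlonglongrightarrow> f x"
      "\<And>n x. x \<in> space M \<Longrightarrow> cmod (s n x - f x) \<le> cmod (f x)"
  shows "(\<lambda>n. \<Sum>y\<in>s n ` space M. y * \<mu> {x \<in> space M. s n x = y}) \<longlonglongrightarrow> cm_integral M \<mu> f"
proof -
  have real_part: "(\<lambda>n. \<Sum>y\<in>s n ` space M. y * of_real (\<nu> {x \<in> space M. s n x = y}))
      \<longlonglongrightarrow> integral\<^sup>L (positive_variation M \<nu>) f - integral\<^sup>L (positive_variation M (\<lambda>X. - \<nu> X)) f"
    if \<nu>: "complex_measure M (\<lambda>X. of_real (\<nu> X))" and le: "\<And>X. \<bar>\<nu> X\<bar> \<le> cmod (\<mu> X)"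
    for \<nu> :: "'o set \<Rightarrow> real"
  proof -
    have \<nu>': "complex_measure M (\<lambda>X. of_real (- \<nu> X))"
      using \<nu> by (auto simp: complex_measure_def sums_minus)
    have le': "positive_variation M \<nu> \<le> total_variation M \<mu>"
      "positive_variation M (\<lambda>X. - \<nu> X) \<le> total_variation M \<mu>"
      using le by (auto intro!: positive_variation_le_total_variation \<mu> \<nu> \<nu>' simp: abs_le_iff)
    have "of_real (\<nu> {x \<in> space M. s n x = y}) =
        complex_of_real (measure (positive_variation M \<nu>) {x \<in> space M. s n x = y})
        - of_real (measure (positive_variation M (\<lambda>X. - \<nu> X)) {x \<in> space M. s n x = y})" for n y
      by (subst Jordan_decomposition[OF \<nu> finite_positive_variation[OF le'(1) fin]
            finite_positive_variation[OF le'(2) fin] sets_level_set[OF s(1)], symmetric])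
        (rule of_real_diff)
    moreover have "(\<lambda>n. (\<Sum>y\<in>s n ` space M. y * of_real (measure (positive_variation M \<nu>) {x \<in> space M. s n x = y}))
        - (\<Sum>y\<in>s n ` space M. y * of_real (measure (positive_variation M (\<lambda>X. - \<nu> X)) {x \<in> space M. s n x = y})))
      \<longlonglongrightarrow> integral\<^sup>L (positive_variation M \<nu>) f - integral\<^sup>L (positive_variation M (\<lambda>X. - \<nu> X)) f"
      by (rule tendsto_diff; rule positive_variation_integral_tendsto[OF _ fin f]) (use s le' in auto)
    ultimately show ?thesis
      by (simp only: right_diff_distrib sum_subtractf)
  qed
  have Re: "complex_measure M (\<lambda>X. of_real (Re (\<mu> X)))" and Im: "complex_measure M (\<lambda>X. of_real (Im (\<mu> X)))"
    unfolding complex_measure_def sums_of_real_iff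
    by (intro allI impI sums_Re sums_Im \<mu>[unfolded complex_measure_def, rule_format]; assumption)+
  have split: "y * z = y * of_real (Re z) + \<i> * (y * of_real (Im z))" for y z
    by (simp add: complex_eq_iff)
  have "(\<Sum>y\<in>s n ` space M. y * \<mu> {x \<in> space M. s n x = y}) =
      (\<Sum>y\<in>s n ` space M. y * of_real (Re (\<mu> {x \<in> space M. s n x = y})))
      + \<i> * (\<Sum>y\<in>s n ` space M. y * of_real (Im (\<mu> {x \<in> space M. s n x = y})))" for n
    unfolding sum_distrib_left sum.distrib[symmetric] by (intro sum.cong refl split)
  then show ?thesis
    unfolding cm_integral_def
    by (simp only:) (intro tendsto_intros real_part Re Im abs_Re_le_cmod abs_Im_le_cmod)
qed

section \<open>Projection valued measures\<close>

locale projection_valued_measure =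
  fixes M :: "'o measure" and E :: "'o set \<Rightarrow> 'h::chilbert_space \<Rightarrow> 'h"
  assumes povm: "povm M E" and proj: "projection_valued M E"
begin

lemma linear_E: "X \<in> sets M \<Longrightarrow> linear (E X)"
  using proj by (auto simp: projection_valued_def orthogonal_projection_def bounded_clinear_def
      bounded_linear.linear)

lemma E_scaleC: "X \<in> sets M \<Longrightarrow> E X (c *\<^sub>C \<phi>) = c *\<^sub>C E X \<phi>"
  using proj by (auto simp: projection_valued_def orthogonal_projection_def bounded_clinear_def)

lemma E_idem: "X \<in> sets M \<Longrightarrow> E X (E X \<phi>) = E X \<phi>"
  using proj by (auto simp: projection_valued_def orthogonal_projection_def)

lemma E_selfadjoint: "X \<in> sets M \<Longrightarrow> cinner \<psi> (E X \<phi>) = cinner (E X \<psi>) \<phi>"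
  using proj unfolding projection_valued_def orthogonal_projection_def by blast

lemma cinner_E_self: "X \<in> sets M \<Longrightarrow> cinner \<phi> (E X \<phi>) = of_real ((norm (E X \<phi>))\<^sup>2)"
  by (metis E_idem E_selfadjoint cinner_self)

lemma norm_E_le:
  assumes "X \<in> sets M"
  shows "norm (E X \<phi>) \<le> norm \<phi>"
proof -
  have "(norm (E X \<phi>))\<^sup>2 = cmod (cinner \<phi> (E X \<phi>))"
    unfolding cinner_E_self[OF assms] norm_of_real by simp
  also have "\<dots> \<le> norm \<phi> * norm (E X \<phi>)"
    by (rule cinner_Cauchy_Schwarz)
  finally show ?thesis
    by (cases "norm (E X \<phi>) = 0") (auto simp: power2_eq_square)
qed

lemma E_empty: "E {} \<phi> = 0"
proof -
  have "(\<lambda>n::nat. E {} \<phi>) sums E {} \<phi>"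
    using povm[unfolded povm_def, THEN conjunct2, rule_format, of "\<lambda>_. {}" \<phi>]
    by (auto simp: disjoint_family_on_def)
  then show ?thesis
    using sums_summable summable_const_iff by blast
qed

lemma E_union:
  assumes "X \<in> sets M" "Y \<in> sets M" "X \<inter> Y = {}"
  shows "E (X \<union> Y) \<phi> = E X \<phi> + E Y \<phi>"
proof -
  have "(\<lambda>n. E (binaryset X Y n) \<phi>) sums E (\<Union>n. binaryset X Y n) \<phi>"
    using assms by (intro povm[unfolded povm_def, THEN conjunct2, rule_format])
      (auto simp: range_binaryset_eq disjoint_family_on_def binaryset_def)
  moreover have "(\<lambda>n. E (binaryset X Y n) \<phi>) sums (E X \<phi> + E Y \<phi>)"
    by (rule binaryset_sums) (rule E_empty)
  ultimately show ?thesis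
    using sums_unique2 UN_binaryset_eq by metis
qed

text \<open>Let \<open>x\<close> be in the range of \<open>E X\<close>. The squared norms of \<open>E X x = x\<close> and of \<open>E Y x\<close> add up to that of
  \<open>E (X \<union> Y) x\<close>, which is at most the squared norm of \<open>x\<close>. So nothing is left for \<open>E Y x\<close>.\<close>

lemma E_disjoint:
  assumes "X \<in> sets M" "Y \<in> sets M" "X \<inter> Y = {}"
  shows "E Y (E X \<phi>) = 0"
proof -
  let ?x = "E X \<phi>"
  have XY: "X \<union> Y \<in> sets M" using assms by auto
  have "cinner ?x (E (X \<union> Y) ?x) = cinner ?x (E X ?x) + cinner ?x (E Y ?x)"
    by (simp add: E_union[OF assms] cinner_add_right)
  then have "complex_of_real ((norm (E (X \<union> Y) ?x))\<^sup>2) = of_real ((norm (E X ?x))\<^sup>2 + (norm (E Y ?x))\<^sup>2)"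
    using assms XY by (simp only: cinner_E_self of_real_add)
  then have "(norm (E (X \<union> Y) ?x))\<^sup>2 = (norm ?x)\<^sup>2 + (norm (E Y ?x))\<^sup>2"
    unfolding of_real_eq_iff E_idem[OF assms(1)] .
  moreover have "(norm (E (X \<union> Y) ?x))\<^sup>2 \<le> (norm ?x)\<^sup>2"
    using norm_E_le[OF XY] by (simp add: power_mono)
  ultimately show ?thesis by simp
qed

lemma E_mult:
  assumes "X \<in> sets M" "Y \<in> sets M"
  shows "E X (E Y \<phi>) = E (X \<inter> Y) \<phi>"
proof -
  have X: "E X \<psi> = E (X \<inter> Y) \<psi> + E (X - Y) \<psi>" for \<psi>
    using assms E_union[of "X \<inter> Y" "X - Y" \<psi>] by (auto simp: Int_Diff_Un)
  have Y: "E Y \<phi> = E (X \<inter> Y) \<phi> + E (Y - X) \<phi>"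
    using assms E_union[of "X \<inter> Y" "Y - X" \<phi>] by (auto simp: Int_commute[of X] Int_Diff_Un)
  have "E (X - Y) (E Y \<phi>) = 0"
    using assms by (intro E_disjoint) auto
  moreover have "E (X \<inter> Y) (E (Y - X) \<phi>) = 0"
    using assms by (intro E_disjoint) auto
  moreover have "E (X \<inter> Y) (E (X \<inter> Y) \<phi>) = E (X \<inter> Y) \<phi>"
    using assms by (intro E_idem) auto
  moreover have "linear (E (X \<inter> Y))"
    using assms by (intro linear_E) auto
  ultimately show ?thesis
    unfolding X[of "E Y \<phi>"] by (simp add: Y linear_add)
qed

abbreviation diag :: "'h \<Rightarrow> 'o measure"
  where "diag \<equiv> povm_diag M E"

lemma sets_diag [simp, measurable_cong]: "sets (diag \<phi>) = sets M"
  by (simp add: povm_diag_def)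

lemma space_diag [simp]: "space (diag \<phi>) = space M"
  by (rule sets_eq_imp_space_eq) simp

lemma emeasure_diag: "X \<in> sets M \<Longrightarrow> emeasure (diag \<phi>) X = ennreal ((norm (E X \<phi>))\<^sup>2)"
  by (simp add: emeasure_povm_diag[OF povm] povm_cm_def cinner_E_self del: of_real_power)

lemma measure_diag: "X \<in> sets M \<Longrightarrow> measure (diag \<phi>) X = (norm (E X \<phi>))\<^sup>2"
  by (simp add: measure_def emeasure_diag)

lemma finite_measure_diag: "finite_measure (diag \<phi>)"
  by (rule finite_measureI) (simp add: emeasure_diag)

section \<open>Operator integrals of simple functions\<close>

definition simple_op :: "('o \<Rightarrow> complex) \<Rightarrow> 'h \<Rightarrow> 'h"
  where "simple_op s \<phi> = (\<Sum>y\<in>s ` space M. y *\<^sub>C E {x \<in> space M. s x = y} \<phi>)"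

lemma cinner_simple_op_right:
  "cinner \<psi> (simple_op s \<phi>) = (\<Sum>y\<in>s ` space M. y * povm_cm E \<psi> \<phi> {x \<in> space M. s x = y})"
  by (simp add: simple_op_def cinner_sum_right cinner_scaleC_right povm_cm_def)

text \<open>Multiplicativity of \<open>E\<close> enters here: the cells of the two partitions into level sets
  contribute the diagonal measure of their intersections.\<close>

lemma cinner_simple_op:
  assumes g: "simple_function M g" and s: "simple_function M s"
  shows "cinner (simple_op g \<phi>) (simple_op s \<phi>) = (\<integral>x. cnj (g x) * s x \<partial>diag \<phi>)"
proof -
  interpret finite_measure "diag \<phi>" by (rule finite_measure_diag)
  let ?G = "\<lambda>y. {x \<in> space M. g x = y}" and ?S = "\<lambda>y. {x \<in> space M. s x = y}"
  have [measurable]: "?G y \<in> sets M" "?S y \<in> sets M" for y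
    using g s by (auto intro: sets_level_set)
  have fin: "finite (g ` space M)" "finite (s ` space M)"
    using g s by (auto dest: simple_functionD)
  have cell: "cinner (E (?G y) \<phi>) (E (?S z) \<phi>) = of_real (measure (diag \<phi>) (?G y \<inter> ?S z))" for y z
    by (simp add: E_selfadjoint[symmetric] E_mult cinner_E_self measure_diag del: of_real_power)
  have "has_bochner_integral (diag \<phi>) (\<lambda>x. indicator (?G y \<inter> ?S z) x *\<^sub>R c)
      (measure (diag \<phi>) (?G y \<inter> ?S z) *\<^sub>R c)" for y z and c :: complex
    by (intro has_bochner_integral_indicator) (auto simp: less_top[symmetric])
  then have int: "integrable (diag \<phi>) (\<lambda>x. indicator (?G y \<inter> ?S z) x *\<^sub>R c)"
    and val: "(\<integral>x. indicator (?G y \<inter> ?S z) x *\<^sub>R c \<partial>diag \<phi>) = measure (diag \<phi>) (?G y \<inter> ?S z) *\<^sub>R c"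
    for y z and c :: complex
    by (simp_all only: has_bochner_integral_iff)
  have "cinner (simple_op g \<phi>) (simple_op s \<phi>) =
      (\<Sum>y\<in>g ` space M. \<Sum>z\<in>s ` space M. measure (diag \<phi>) (?G y \<inter> ?S z) *\<^sub>R (cnj y * z))"
    unfolding simple_op_def cinner_sum_left cinner_scaleC_left
    unfolding cinner_sum_right cinner_scaleC_right cell sum_distrib_left
    by (simp only: scaleR_conv_of_real ac_simps)
  also have "\<dots> = (\<integral>x. (\<Sum>y\<in>g ` space M. \<Sum>z\<in>s ` space M.
      indicator (?G y \<inter> ?S z) x *\<^sub>R (cnj y * z)) \<partial>diag \<phi>)"
    by (simp only: int val Bochner_Integration.integral_sum Bochner_Integration.integrable_sum)
  also have "\<dots> = (\<integral>x. cnj (g x) * s x \<partial>diag \<phi>)"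
  proof (rule Bochner_Integration.integral_cong)
    fix x assume "x \<in> space (diag \<phi>)"
    then have x: "x \<in> space M" by simp
    have "indicator (?G y \<inter> ?S z) x *\<^sub>R (cnj y * z) =
        (if y = g x then if z = s x then cnj y * z else 0 else 0)" for y z
      using x by (auto simp: indicator_def)
    then have "(\<Sum>y\<in>g ` space M. \<Sum>z\<in>s ` space M. indicator (?G y \<inter> ?S z) x *\<^sub>R (cnj y * z)) =
        (\<Sum>y\<in>g ` space M. if y = g x then \<Sum>z\<in>s ` space M. if z = s x then cnj y * z else 0 else 0)"
      by (auto intro!: sum.cong)
    also have "\<dots> = cnj (g x) * s x"
      using x fin by simp
    finally show "(\<Sum>y\<in>g ` space M. \<Sum>z\<in>s ` space M. indicator (?G y \<inter> ?S z) x *\<^sub>R (cnj y * z))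
        = cnj (g x) * s x" .
  qed simp
  finally show ?thesis .
qed

lemma norm_simple_op:
  assumes s: "simple_function M s"
  shows "integrable (diag \<phi>) (\<lambda>x. (cmod (s x))\<^sup>2)"
    and "(norm (simple_op s \<phi>))\<^sup>2 = (\<integral>x. (cmod (s x))\<^sup>2 \<partial>diag \<phi>)"
proof -
  have "simple_function M (\<lambda>x. (cmod (s x))\<^sup>2)"
    by (rule simple_function_compose1[OF s])
  then show "integrable (diag \<phi>) (\<lambda>x. (cmod (s x))\<^sup>2)"
    by (rule simple_function_integral(1)[OF finite_measure_diag sets_diag])
  have "complex_of_real ((norm (simple_op s \<phi>))\<^sup>2) = (\<integral>x. cnj (s x) * s x \<partial>diag \<phi>)"
    using cinner_simple_op[OF s s] by (simp only: cinner_self)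
  also have "\<dots> = of_real (\<integral>x. (cmod (s x))\<^sup>2 \<partial>diag \<phi>)"
    unfolding integral_complex_of_real[symmetric] complex_norm_square by (simp only: mult.commute)
  finally show "(norm (simple_op s \<phi>))\<^sup>2 = (\<integral>x. (cmod (s x))\<^sup>2 \<partial>diag \<phi>)"
    by (simp only: of_real_eq_iff)
qed

lemma nn_integral_simple_op:
  assumes "simple_function M s"
  shows "(\<integral>\<^sup>+ x. ennreal ((cmod (s x))\<^sup>2) \<partial>diag \<phi>) = ennreal ((norm (simple_op s \<phi>))\<^sup>2)"
  by (simp add: norm_simple_op[OF assms] nn_integral_eq_integral)

lemma E_simple_op:
  assumes X: "X \<in> sets M" and s: "simple_function M s"
  shows "E X (simple_op s \<phi>) = simple_op s (E X \<phi>)"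
  using X sets_level_set[OF s]
  by (simp add: simple_op_def linear_sum[OF linear_E[OF X]] E_scaleC E_mult Int_commute)

text \<open>By this estimate \<open>simple_op s\<close> maps the form domain into itself, which admits the vectors
  \<open>simple_op s \<phi>\<close> as arguments of the weak functional.\<close>

lemma norm_E_simple_op_le:
  assumes X: "X \<in> sets M" and s: "simple_function M s" and K: "\<And>x. x \<in> space M \<Longrightarrow> cmod (s x) \<le> K"
  shows "(norm (E X (simple_op s \<phi>)))\<^sup>2 \<le> K\<^sup>2 * (norm (E X \<phi>))\<^sup>2"
proof -
  interpret finite_measure "diag (E X \<phi>)" by (rule finite_measure_diag)
  have "(norm (E X (simple_op s \<phi>)))\<^sup>2 = (\<integral>x. (cmod (s x))\<^sup>2 \<partial>diag (E X \<phi>))"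
    by (simp add: E_simple_op[OF X s] norm_simple_op[OF s])
  also have "\<dots> \<le> (\<integral>x. K\<^sup>2 \<partial>diag (E X \<phi>))"
    using K by (intro integral_mono norm_simple_op(1) s power_mono) auto
  also have "\<dots> = K\<^sup>2 * (norm (E (space M) (E X \<phi>)))\<^sup>2"
    by (simp add: measure_diag)
  also have "\<dots> \<le> K\<^sup>2 * (norm (E X \<phi>))\<^sup>2"
    by (intro mult_left_mono power_mono norm_E_le) auto
  finally show ?thesis .
qed

section \<open>Total variation and integrability\<close>

text \<open>Since \<open>\<langle>\<psi>|E(A)\<phi>\<rangle> = \<langle>E(A)\<psi>|E(A)\<phi>\<rangle>\<close>, the Cauchy--Schwarz inequality applies on each cell of a
  partition. Keeping it in the form \<open>t a b \<le> a\<^sup>2 + t\<^sup>2 b\<^sup>2\<close> makes both sides additive.\<close>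

lemma total_variation_povm_le:
  assumes X: "X \<in> sets M" and t: "t < \<infinity>"
  shows "t * emeasure (total_variation M (povm_cm E \<psi> \<phi>)) X
    \<le> emeasure (diag \<psi>) X + t\<^sup>2 * emeasure (diag \<phi>) X"
proof -
  have cell: "t * ennreal (cmod (povm_cm E \<psi> \<phi> A)) \<le> emeasure (diag \<psi>) A + t\<^sup>2 * emeasure (diag \<phi>) A"
    if A: "A \<in> sets M" for A
  proof -
    obtain r where r: "t = ennreal r" "0 \<le> r"
      using t by (cases t) auto
    let ?a = "norm (E A \<psi>)" and ?b = "norm (E A \<phi>)"
    have "cmod (povm_cm E \<psi> \<phi> A) = cmod (cinner (E A \<psi>) (E A \<phi>))"
      by (simp add: povm_cm_def E_selfadjoint[OF A] E_idem[OF A])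
    also have "\<dots> \<le> ?a * ?b"
      by (rule cinner_Cauchy_Schwarz)
    finally have "r * cmod (povm_cm E \<psi> \<phi> A) \<le> r * (?a * ?b)"
      using r(2) by (rule mult_left_mono)
    then have "r * cmod (povm_cm E \<psi> \<phi> A) \<le> ?a * (r * ?b)"
      by (simp add: ac_simps)
    also have "\<dots> \<le> ?a\<^sup>2 + (r * ?b)\<^sup>2"
    proof -
      have "0 \<le> ?a * (r * ?b)"
        using r(2) by simp
      with sum_squares_bound[of ?a "r * ?b", unfolded mult.assoc] show ?thesis
        by linarith
    qed
    finally have "r * cmod (povm_cm E \<psi> \<phi> A) \<le> ?a\<^sup>2 + r\<^sup>2 * ?b\<^sup>2"
      by (simp add: power_mult_distrib)
    then have "ennreal (r * cmod (povm_cm E \<psi> \<phi> A)) \<le> ennreal (?a\<^sup>2 + r\<^sup>2 * ?b\<^sup>2)"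
      by (rule ennreal_leI)
    then show ?thesis
      using r(2) by (simp add: r(1) emeasure_diag[OF A] ennreal_mult ennreal_power)
  qed
  show ?thesis
    unfolding emeasure_total_variation[OF complex_measure_povm_cm[OF povm] X] SUP_mult_left_ennreal
  proof (rule SUP_least)
    fix P assume P: "P \<in> {P. finite P \<and> P \<subseteq> sets M \<and> partition_on X P}"
    then have disj: "disjoint_family_on (\<lambda>A. A) P" and "\<Union>P = X"
      by (auto simp: partition_on_def disjoint_family_on_def disjoint_def)
    then have sum: "(\<Sum>A\<in>P. emeasure (diag \<eta>) A) = emeasure (diag \<eta>) X" for \<eta>
      using P sum_emeasure[of "\<lambda>A. A" P "diag \<eta>"] by auto
    have "t * (\<Sum>A\<in>P. ennreal (cmod (povm_cm E \<psi> \<phi> A))) \<le>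
        (\<Sum>A\<in>P. emeasure (diag \<psi>) A + t\<^sup>2 * emeasure (diag \<phi>) A)"
      unfolding sum_distrib_left using P by (intro sum_mono cell) auto
    also have "\<dots> = emeasure (diag \<psi>) X + t\<^sup>2 * emeasure (diag \<phi>) X"
      by (simp add: sum.distrib sum_distrib_left[symmetric] sum)
    finally show "t * (\<Sum>A\<in>P. ennreal (cmod (povm_cm E \<psi> \<phi> A)))
        \<le> emeasure (diag \<psi>) X + t\<^sup>2 * emeasure (diag \<phi>) X" .
  qed
qed

lemma total_variation_povm_finite:
  "emeasure (total_variation M (povm_cm E \<psi> \<phi>)) (space M) < \<infinity>"
proof -
  have "emeasure (total_variation M (povm_cm E \<psi> \<phi>)) (space M) \<le>
      emeasure (diag \<psi>) (space M) + emeasure (diag \<phi>) (space M)"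
    using total_variation_povm_le[of "space M" 1 \<psi> \<phi>] by simp
  also have "\<dots> < \<infinity>"
    by (simp add: emeasure_diag)
  finally show ?thesis .
qed

lemma square_domain_subset_strong_domain: "square_domain M E f \<subseteq> strong_domain M E f"
proof
  fix \<phi> assume \<phi>: "\<phi> \<in> square_domain M E f"
  show "\<phi> \<in> strong_domain M E f"
    unfolding strong_domain_def
  proof safe
    fix \<psi>
    have "(\<integral>\<^sup>+ x. ennreal (cmod (f x)) \<partial>total_variation M (povm_cm E \<psi> \<phi>)) \<le>
        (\<integral>\<^sup>+ x. 1 \<partial>diag \<psi>) + (\<integral>\<^sup>+ x. (ennreal (cmod (f x)))\<^sup>2 \<partial>diag \<phi>)"
      using total_variation_povm_le[of _ _ \<psi> \<phi>]
      by (intro nn_integral_le_of_level[where u = "\<lambda>_. 1" and v = power2]) (auto simp: mono_def power_mono)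
    also have "\<dots> < \<infinity>"
      using \<phi> by (simp add: square_domain_def ennreal_power emeasure_diag)
    finally show "(\<integral>\<^sup>+ x. ennreal (cmod (f x)) \<partial>total_variation M (povm_cm E \<psi> \<phi>)) < \<infinity>" .
  qed
qed

lemma square_domain_subset_form_domain:
  assumes [measurable]: "f \<in> borel_measurable M"
  shows "square_domain M E f \<subseteq> form_domain M E f"
proof
  fix \<phi> assume \<phi>: "\<phi> \<in> square_domain M E f"
  have "(\<integral>\<^sup>+ x. ennreal (cmod (f x)) \<partial>diag \<phi>) \<le> (\<integral>\<^sup>+ x. 1 + ennreal ((cmod (f x))\<^sup>2) \<partial>diag \<phi>)"
  proof (rule nn_integral_mono)
    fix x
    have "cmod (f x) \<le> 1 + (cmod (f x))\<^sup>2"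
      using sum_squares_bound[of 1 "cmod (f x)", unfolded one_power2 mult_1_right] norm_ge_zero[of "f x"]
      by linarith
    then show "ennreal (cmod (f x)) \<le> 1 + ennreal ((cmod (f x))\<^sup>2)"
      by (metis ennreal_1 ennreal_leI ennreal_plus zero_le_one zero_le_power2)
  qed
  also have "\<dots> = emeasure (diag \<phi>) (space M) + (\<integral>\<^sup>+ x. ennreal ((cmod (f x))\<^sup>2) \<partial>diag \<phi>)"
    by (subst nn_integral_add) auto
  also have "\<dots> < \<infinity>"
    using \<phi> by (simp add: square_domain_def emeasure_diag)
  finally show "\<phi> \<in> form_domain M E f"
    by (simp add: form_domain_def)
qed

lemma form_domain_integrable:
  assumes "\<psi> \<in> form_domain M E f" "\<phi> \<in> form_domain M E f"
  shows "(\<integral>\<^sup>+ x. ennreal (cmod (f x)) \<partial>total_variation M (povm_cm E \<psi> \<phi>)) < \<infinity>"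
proof -
  have "(\<integral>\<^sup>+ x. ennreal (cmod (f x)) \<partial>total_variation M (povm_cm E \<psi> \<phi>)) \<le>
      (\<integral>\<^sup>+ x. ennreal (cmod (f x)) \<partial>diag \<psi>) + (\<integral>\<^sup>+ x. ennreal (cmod (f x)) \<partial>diag \<phi>)"
  proof (rule nn_integral_le_of_level[where u = "\<lambda>t. t" and v = "\<lambda>t. t"])
    fix X and t :: ennreal assume X: "X \<in> sets (total_variation M (povm_cm E \<psi> \<phi>))"
    show "t * emeasure (total_variation M (povm_cm E \<psi> \<phi>)) X \<le>
        t * emeasure (diag \<psi>) X + t * emeasure (diag \<phi>) X"
      unfolding distrib_left[symmetric]
      using X total_variation_povm_le[of X 1 \<psi> \<phi>] by (intro mult_left_mono) auto
  qed (auto simp: mono_def)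
  also have "\<dots> < \<infinity>"
    using assms by (simp add: form_domain_def)
  finally show ?thesis .
qed

lemma form_domain_le:
  assumes \<phi>: "\<phi> \<in> form_domain M E f" and "0 \<le> C"
    and le: "\<And>X. X \<in> sets M \<Longrightarrow> (norm (E X \<psi>))\<^sup>2 \<le> C * (norm (E X \<phi>))\<^sup>2"
    and [measurable]: "f \<in> borel_measurable M"
  shows "\<psi> \<in> form_domain M E f"
proof -
  have "diag \<psi> \<le> scale_measure (ennreal C) (diag \<phi>)"
    using le \<open>0 \<le> C\<close> by (subst le_measure)
      (auto simp: emeasure_diag ennreal_mult[symmetric] intro!: ennreal_leI simp del: ennreal_mult)
  then have "(\<integral>\<^sup>+ x. ennreal (cmod (f x)) \<partial>diag \<psi>) \<le>
      (\<integral>\<^sup>+ x. ennreal (cmod (f x)) \<partial>scale_measure (ennreal C) (diag \<phi>))"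
    by (intro nn_integral_mono_measure) auto
  also have "\<dots> = ennreal C * (\<integral>\<^sup>+ x. ennreal (cmod (f x)) \<partial>diag \<phi>)"
    by (rule nn_integral_scale_measure) measurable
  also have "\<dots> < \<infinity>"
    using \<phi> by (simp add: form_domain_def ennreal_mult_less_top)
  finally show ?thesis
    by (simp add: form_domain_def)
qed

text \<open>The part of \<open>\<psi>\<close> where \<open>\<bar>f\<bar> > n\<close> tends to zero. Subtracting it, rather than projecting onto the
  part where \<open>\<bar>f\<bar> \<le> n\<close>, keeps the component of \<open>\<psi>\<close> orthogonal to the range of \<open>E (space M)\<close>,
  which lies in the form domain and may be nonzero.\<close>

lemma form_domain_dense:
  assumes [measurable]: "f \<in> borel_measurable M"
  obtains u where "\<And>n::nat. u n \<in> form_domain M E f" "u \<longlonglongrightarrow> \<psi>"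
proof -
  interpret finite_measure "diag \<psi>" by (rule finite_measure_diag)
  define Y where "Y n = {x \<in> space M. real n < cmod (f x)}" for n
  have Y [measurable]: "Y n \<in> sets M" for n
    unfolding Y_def by measurable
  define u where "u n = \<psi> - E (Y n) \<psi>" for n
  have "u n \<in> form_domain M E f" for n
  proof -
    have "E (Y n) (u n) = 0"
      using Y by (simp add: u_def linear_diff[OF linear_E] E_idem)
    then have "AE x in diag (u n). cmod (f x) \<le> real n"
      by (intro AE_I[of _ _ "Y n"]) (auto simp: Y_def[symmetric] emeasure_diag[OF Y] not_le)
    then have "(\<integral>\<^sup>+ x. ennreal (cmod (f x)) \<partial>diag (u n)) \<le> (\<integral>\<^sup>+ x. ennreal (real n) \<partial>diag (u n))"
      by (intro nn_integral_mono_AE) (auto intro: ennreal_leI)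
    also have "\<dots> < \<infinity>"
      by (simp add: emeasure_diag ennreal_mult_less_top)
    finally show ?thesis
      by (simp add: form_domain_def)
  qed
  moreover have "u \<longlonglongrightarrow> \<psi>"
  proof -
    have "(\<lambda>n. measure (diag \<psi>) (Y n)) \<longlonglongrightarrow> measure (diag \<psi>) (\<Inter>n. Y n)"
      by (intro finite_Lim_measure_decseq) (auto simp: decseq_def Y_def)
    moreover have "(\<Inter>n. Y n) = {}"
    proof -
      have "x \<notin> (\<Inter>n. Y n)" for x
        using real_arch_simple[of "cmod (f x)"] by (auto simp: Y_def not_less)
      then show ?thesis by blast
    qed
    ultimately have "(\<lambda>n. sqrt ((norm (E (Y n) \<psi>))\<^sup>2)) \<longlonglongrightarrow> sqrt 0"
      by (intro tendsto_real_sqrt) (simp add: measure_diag)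
    then have "(\<lambda>n. E (Y n) \<psi>) \<longlonglongrightarrow> 0"
      by (simp add: tendsto_norm_zero_iff)
    then have "(\<lambda>n. \<psi> - E (Y n) \<psi>) \<longlonglongrightarrow> \<psi> - 0"
      by (intro tendsto_intros)
    then show ?thesis
      by (simp add: u_def[abs_def])
  qed
  ultimately show ?thesis
    using that by blast
qed

end

section \<open>The three domains\<close>

text \<open>One sequence of simple functions serves all arguments about \<open>f\<close>, and nothing proved about the
  domains and the operators depends on its choice.\<close>

locale simple_approximants = projection_valued_measure M E
  for M :: "'o measure" and E :: "'o set \<Rightarrow> 'h::chilbert_space \<Rightarrow> 'h" +
  fixes f :: "'o \<Rightarrow> complex" and s :: "nat \<Rightarrow> 'o \<Rightarrow> complex"
  assumes f [measurable]: "f \<in> borel_measurable M"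
    and simple: "\<And>n. simple_function M (s n)"
    and lim: "\<And>x. x \<in> space M \<Longrightarrow> (\<lambda>n. s n x) \<longlonglongrightarrow> f x"
    and close: "\<And>n x. x \<in> space M \<Longrightarrow> cmod (s n x - f x) \<le> cmod (f x)"
begin

lemma simple_measurable [measurable]: "s n \<in> borel_measurable M"
  using simple by (rule borel_measurable_simple_function)

lemma cnj_simple_measurable [measurable]: "(\<lambda>x. cnj (s n x)) \<in> borel_measurable M"
  using simple_function_compose1[OF simple] by (rule borel_measurable_simple_function)

lemma norm_simple_le: "x \<in> space M \<Longrightarrow> cmod (s n x) \<le> 2 * cmod (f x)"
  using close[of x n] norm_triangle_ineq2[of "s n x" "f x"] by simp

lemma cm_integral_povm_tendsto:
  assumes "(\<integral>\<^sup>+ x. ennreal (cmod (f x)) \<partial>total_variation M (povm_cm E \<psi> \<phi>)) < \<infinity>"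
  shows "(\<lambda>n. cinner \<psi> (simple_op (s n) \<phi>)) \<longlonglongrightarrow> cm_integral M (povm_cm E \<psi> \<phi>) f"
  unfolding cinner_simple_op_right
  by (rule cm_integral_tendsto[OF complex_measure_povm_cm[OF povm] total_variation_povm_finite f assms])
    (use simple lim close in auto)

text \<open>Both inclusions into the square integrability domain end here. The squared norms are the
  integrals of \<open>\<bar>s n\<bar>\<^sup>2\<close> for the diagonal measure, and Fatou's lemma passes their bound on to \<open>f\<close>.\<close>

lemma square_domainI:
  assumes "\<And>n. norm (simple_op (s n) \<phi>) \<le> C"
  shows "\<phi> \<in> square_domain M E f"
proof -
  have "(\<integral>\<^sup>+ x. ennreal ((cmod (f x))\<^sup>2) \<partial>diag \<phi>) =
      (\<integral>\<^sup>+ x. liminf (\<lambda>n. ennreal ((cmod (s n x))\<^sup>2)) \<partial>diag \<phi>)"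
  proof (rule nn_integral_cong)
    fix x assume "x \<in> space (diag \<phi>)"
    then have "(\<lambda>n. ennreal ((cmod (s n x))\<^sup>2)) \<longlonglongrightarrow> ennreal ((cmod (f x))\<^sup>2)"
      by (intro tendsto_ennrealI tendsto_intros lim) simp
    then show "ennreal ((cmod (f x))\<^sup>2) = liminf (\<lambda>n. ennreal ((cmod (s n x))\<^sup>2))"
      by (simp only: lim_imp_Liminf[OF sequentially_bot])
  qed
  also have "\<dots> \<le> liminf (\<lambda>n. \<integral>\<^sup>+ x. ennreal ((cmod (s n x))\<^sup>2) \<partial>diag \<phi>)"
    by (rule nn_integral_liminf) measurable
  also have "\<dots> \<le> liminf (\<lambda>n::nat. ennreal (C\<^sup>2))"
    using assms
    by (intro Liminf_mono always_eventually allI)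
      (auto simp: nn_integral_simple_op[OF simple] intro!: ennreal_leI power_mono)
  also have "\<dots> < \<infinity>"
    by (simp add: Liminf_const)
  finally show ?thesis
    by (simp add: square_domain_def)
qed

lemma norm_simple_op_bounded:
  assumes \<phi>: "\<phi> \<in> square_domain M E f"
  obtains C where "\<And>n. norm (simple_op (s n) \<phi>) \<le> C"
proof -
  have int: "integrable (diag \<phi>) (\<lambda>x. (cmod (f x))\<^sup>2)"
    using \<phi> by (intro integrableI_bounded) (auto simp: square_domain_def)
  have "norm (simple_op (s n) \<phi>) \<le> sqrt (\<integral>x. 4 * (cmod (f x))\<^sup>2 \<partial>diag \<phi>)" for n
  proof (rule real_le_rsqrt)
    have "(cmod (s n x))\<^sup>2 \<le> 4 * (cmod (f x))\<^sup>2" if "x \<in> space M" for x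
      using power_mono[OF norm_simple_le[OF that, of n], of 2] by (simp add: power_mult_distrib)
    then show "(norm (simple_op (s n) \<phi>))\<^sup>2 \<le> (\<integral>x. 4 * (cmod (f x))\<^sup>2 \<partial>diag \<phi>)"
      unfolding norm_simple_op(2)[OF simple]
      using int by (intro integral_mono norm_simple_op(1) simple) auto
  qed
  then show ?thesis
    using that by blast
qed

text \<open>The integral is a pointwise limit, in \<open>\<psi>\<close>, of inner products with the norm bounded vectors
  \<open>simple_op (s n) \<phi>\<close>. The estimate holds on the whole space, which is what allows the passage
  from the form domain to all \<open>\<psi>\<close> later.\<close>

lemma cm_integral_Lipschitz:
  assumes \<phi>: "\<phi> \<in> square_domain M E f"
  obtains C where
    "\<And>\<psi> \<psi>'. cmod (cm_integral M (povm_cm E \<psi> \<phi>) f - cm_integral M (povm_cm E \<psi>' \<phi>) f) \<le> C * norm (\<psi> - \<psi>')"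
proof -
  obtain C where C: "\<And>n. norm (simple_op (s n) \<phi>) \<le> C"
    using norm_simple_op_bounded[OF \<phi>] by blast
  have "\<phi> \<in> strong_domain M E f"
    using \<phi> square_domain_subset_strong_domain by blast
  then have lim: "(\<lambda>n. cinner \<psi> (simple_op (s n) \<phi>)) \<longlonglongrightarrow> cm_integral M (povm_cm E \<psi> \<phi>) f" for \<psi>
    by (intro cm_integral_povm_tendsto) (simp add: strong_domain_def)
  have "cmod (cm_integral M (povm_cm E \<psi> \<phi>) f - cm_integral M (povm_cm E \<psi>' \<phi>) f) \<le> C * norm (\<psi> - \<psi>')"
    for \<psi> \<psi>'
  proof (rule LIMSEQ_le_const2)
    show "(\<lambda>n. cmod (cinner \<psi> (simple_op (s n) \<phi>) - cinner \<psi>' (simple_op (s n) \<phi>)))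
        \<longlonglongrightarrow> cmod (cm_integral M (povm_cm E \<psi> \<phi>) f - cm_integral M (povm_cm E \<psi>' \<phi>) f)"
      by (intro tendsto_intros lim)
    have "cmod (cinner \<psi> (simple_op (s n) \<phi>) - cinner \<psi>' (simple_op (s n) \<phi>)) \<le> C * norm (\<psi> - \<psi>')" for n
    proof -
      have "cmod (cinner (\<psi> - \<psi>') (simple_op (s n) \<phi>)) \<le> norm (\<psi> - \<psi>') * norm (simple_op (s n) \<phi>)"
        by (rule cinner_Cauchy_Schwarz)
      also have "\<dots> \<le> norm (\<psi> - \<psi>') * C"
        by (intro mult_left_mono C) auto
      finally show ?thesis
        by (simp add: cinner_diff_left mult.commute)
    qed
    then show "\<exists>N. \<forall>n\<ge>N. cmod (cinner \<psi> (simple_op (s n) \<phi>) - cinner \<psi>' (simple_op (s n) \<phi>)) \<le> C * norm (\<psi> - \<psi>')"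
      by blast
  qed
  then show ?thesis
    using that by blast
qed

text \<open>For \<open>\<phi>\<close> in the strong domain the vectors \<open>simple_op (s n) \<phi>\<close> converge weakly, hence are weakly
  bounded, hence are bounded in norm.\<close>

lemma strong_domain_subset_square_domain: "strong_domain M E f \<subseteq> square_domain M E f"
proof
  fix \<phi> assume \<phi>: "\<phi> \<in> strong_domain M E f"
  have "\<exists>C. \<forall>n. cmod (cinner \<psi> (simple_op (s n) \<phi>)) \<le> C" for \<psi>
  proof -
    have "convergent (\<lambda>n. cinner \<psi> (simple_op (s n) \<phi>))"
      using \<phi> cm_integral_povm_tendsto[of \<psi> \<phi>] by (auto simp: strong_domain_def convergent_def)
    then have "Bseq (\<lambda>n. cinner \<psi> (simple_op (s n) \<phi>))"
      by (rule convergent_imp_Bseq)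
    then show ?thesis
      by (auto simp: Bseq_def)
  qed
  then obtain C where "\<And>n. norm (simple_op (s n) \<phi>) \<le> C"
    using weakly_bounded_imp_bounded[of "\<lambda>n. simple_op (s n) \<phi>"] by blast
  then show "\<phi> \<in> square_domain M E f"
    by (rule square_domainI)
qed

lemma strong_domain_eq: "strong_domain M E f = square_domain M E f"
  using strong_domain_subset_square_domain square_domain_subset_strong_domain by blast

text \<open>Let \<open>T = simple_op (s n) \<phi>\<close>. The functional \<open>\<psi> \<mapsto> \<integral> f dE\<^sub>\<psi>\<^sub>\<phi>\<close> takes at \<open>T\<close> the value
  \<open>\<integral> cnj (s n) * f\<close> for the diagonal measure of \<open>\<phi>\<close>, whose real part is at least half of
  \<open>\<bar>T\<bar>\<^sup>2\<close>. Continuity at \<open>0\<close> bounds it by a multiple of \<open>\<bar>T\<bar>\<close>. So \<open>\<bar>T\<bar>\<close> is bounded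
  independently of \<open>n\<close>.\<close>

lemma weak_domain_subset_square_domain: "weak_domain M E f \<subseteq> square_domain M E f"
proof
  fix \<phi> assume "\<phi> \<in> weak_domain M E f"
  then have \<phi>: "\<phi> \<in> form_domain M E f"
    and cont: "continuous_on (form_domain M E f) (\<lambda>\<psi>. cm_integral M (povm_cm E \<psi> \<phi>) f)"
    by (auto simp: weak_domain_def)
  have f_int: "integrable (diag \<phi>) (\<lambda>x. cmod (f x))"
    using \<phi> by (intro integrableI_bounded) (auto simp: form_domain_def)
  have zero: "0 \<in> form_domain M E f"
    using \<phi> by (rule form_domain_le[where C = 0]) (simp_all add: linear_0 linear_E)
  have "(\<lambda>n. cinner 0 (simple_op (s n) \<phi>)) \<longlonglongrightarrow> cm_integral M (povm_cm E 0 \<phi>) f"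
    by (intro cm_integral_povm_tendsto form_domain_integrable zero \<phi>)
  then have cm0: "cm_integral M (povm_cm E 0 \<phi>) f = 0"
    by (simp add: LIMSEQ_const_iff)
  obtain \<delta> where \<delta>: "\<delta> > 0"
    and bound: "\<And>\<psi>. \<psi> \<in> form_domain M E f \<Longrightarrow> norm \<psi> < \<delta> \<Longrightarrow> cmod (cm_integral M (povm_cm E \<psi> \<phi>) f) < 1"
    using cont[unfolded continuous_on_iff, rule_format, OF zero, of 1] by (auto simp: cm0 dist_norm)
  have "norm (simple_op (s n) \<phi>) \<le> 4 / \<delta>" for n
  proof (cases "simple_op (s n) \<phi> = 0")
    case False
    let ?T = "simple_op (s n) \<phi>"
    \<comment> \<open>This factor moves \<open>?T\<close> into the ball of radius \<open>\<delta>\<close>, where the functional is less than \<open>1\<close>.\<close>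
    define c where "c = \<delta> / (2 * norm ?T)"
    have c: "c > 0" "c * norm ?T = \<delta> / 2"
      using False \<delta> by (auto simp: c_def)
    define \<psi> where "\<psi> = of_real c *\<^sub>C ?T"
    have "bdd_above (cmod ` s n ` space M)"
      by (intro bdd_above_finite finite_imageI simple_functionD(1)[OF simple])
    then obtain K where K: "\<And>x. x \<in> space M \<Longrightarrow> cmod (s n x) \<le> K"
      by (auto simp: bdd_above_def)
    have \<psi>: "\<psi> \<in> form_domain M E f"
    proof (rule form_domain_le[OF \<phi>])
      fix X assume X: "X \<in> sets M"
      have le: "(norm (E X (simple_op (s n) \<phi>)))\<^sup>2 \<le> K\<^sup>2 * (norm (E X \<phi>))\<^sup>2"
        by (rule norm_E_simple_op_le[OF X simple K])
      show "(norm (E X \<psi>))\<^sup>2 \<le> (c\<^sup>2 * K\<^sup>2) * (norm (E X \<phi>))\<^sup>2"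
        using mult_left_mono[OF le, of "c\<^sup>2"] c(1)
        by (simp add: \<psi>_def E_scaleC[OF X] norm_scaleC power_mult_distrib mult.assoc)
    qed (simp_all add: f)
    have dominated: "norm (cnj (s n x) * f x) \<le> norm (K * cmod (f x))" if "x \<in> space (diag \<phi>)" for x
    proof -
      have "cmod (s n x) * cmod (f x) \<le> \<bar>K\<bar> * cmod (f x)"
        using K[of x] that by (intro mult_right_mono) auto
      then show ?thesis by (simp add: norm_mult abs_mult)
    qed
    have gf_int: "integrable (diag \<phi>) (\<lambda>x. cnj (s n x) * f x)"
    proof (rule Bochner_Integration.integrable_bound)
      show "integrable (diag \<phi>) (\<lambda>x. K * cmod (f x))"
        using f_int by simp
      show "AE x in diag \<phi>. norm (cnj (s n x) * f x) \<le> norm (K * cmod (f x))"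
        by (rule AE_I2) (rule dominated)
    qed measurable
    have "(\<lambda>m. cinner \<psi> (simple_op (s m) \<phi>)) \<longlonglongrightarrow> of_real c * (\<integral>x. cnj (s n x) * f x \<partial>diag \<phi>)"
    proof -
      have "(\<lambda>m. \<integral>x. cnj (s n x) * s m x \<partial>diag \<phi>) \<longlonglongrightarrow> (\<integral>x. cnj (s n x) * f x \<partial>diag \<phi>)"
      proof (rule integral_dominated_convergence)
        show "integrable (diag \<phi>) (\<lambda>x. 2 * (K * cmod (f x)))"
          using f_int by simp
        show "AE x in diag \<phi>. (\<lambda>m. cnj (s n x) * s m x) \<longlonglongrightarrow> cnj (s n x) * f x"
          by (intro AE_I2 tendsto_intros lim) simp
        show "AE x in diag \<phi>. norm (cnj (s n x) * s m x) \<le> 2 * (K * cmod (f x))" for m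
        proof (rule AE_I2)
          fix x assume "x \<in> space (diag \<phi>)"
          then have x: "x \<in> space M" by simp
          have "cmod (s n x) * cmod (s m x) \<le> K * (2 * cmod (f x))"
            using K[OF x] norm_simple_le[OF x, of m] by (intro mult_mono) (auto intro: order_trans[OF norm_ge_zero])
          then show "norm (cnj (s n x) * s m x) \<le> 2 * (K * cmod (f x))"
            by (simp add: norm_mult)
        qed
      qed measurable
      then show ?thesis
        by (auto simp: \<psi>_def cinner_scaleC_left cinner_simple_op[OF simple simple] intro: tendsto_mult_left)
    qed
    moreover have "(\<lambda>m. cinner \<psi> (simple_op (s m) \<phi>)) \<longlonglongrightarrow> cm_integral M (povm_cm E \<psi> \<phi>) f"
      by (intro cm_integral_povm_tendsto form_domain_integrable \<psi> \<phi>)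
    ultimately have "cm_integral M (povm_cm E \<psi> \<phi>) f = of_real c * (\<integral>x. cnj (s n x) * f x \<partial>diag \<phi>)"
      by (rule LIMSEQ_unique[rotated])
    moreover have "norm \<psi> < \<delta>"
      using c \<delta> by (simp add: \<psi>_def norm_scaleC)
    ultimately have *: "cmod (of_real c * (\<integral>x. cnj (s n x) * f x \<partial>diag \<phi>)) < 1"
      using bound[OF \<psi>] by simp
    have "(norm ?T)\<^sup>2 \<le> (\<integral>x. 2 * Re (cnj (s n x) * f x) \<partial>diag \<phi>)"
      unfolding norm_simple_op(2)[OF simple]
    proof (rule integral_mono)
      fix x assume "x \<in> space (diag \<phi>)"
      then have "(cmod (s n x - f x))\<^sup>2 \<le> (cmod (f x))\<^sup>2"
        using close by (intro power_mono) auto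
      then show "(cmod (s n x))\<^sup>2 \<le> 2 * Re (cnj (s n x) * f x)"
        unfolding cmod_power2 by (simp add: power2_eq_square algebra_simps)
    next
      show "integrable (diag \<phi>) (\<lambda>x. 2 * Re (cnj (s n x) * f x))"
        using integrable_Re[OF gf_int] by (rule integrable_mult_right)
    qed (rule norm_simple_op(1)[OF simple])
    also have "\<dots> = 2 * Re (\<integral>x. cnj (s n x) * f x \<partial>diag \<phi>)"
      by (simp only: integral_mult_right_zero integral_Re[OF gf_int])
    finally have "c * (norm ?T)\<^sup>2 \<le> 2 * Re (of_real c * (\<integral>x. cnj (s n x) * f x \<partial>diag \<phi>))"
      using c(1) by simp
    also have "\<dots> < 2"
      using * complex_Re_le_cmod[of "of_real c * (\<integral>x. cnj (s n x) * f x \<partial>diag \<phi>)"] by linarith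
    finally have "(\<delta> / 2) * norm ?T < 2"
      unfolding c(2)[symmetric] by (simp add: power2_eq_square mult.assoc)
    then show ?thesis
      using \<delta> by (simp add: field_simps)
  qed (use \<delta> in simp)
  then show "\<phi> \<in> square_domain M E f"
    by (rule square_domainI)
qed

lemma square_domain_subset_weak_domain: "square_domain M E f \<subseteq> weak_domain M E f"
proof
  fix \<phi> assume \<phi>: "\<phi> \<in> square_domain M E f"
  then obtain C where C: "\<And>\<psi> \<psi>'. cmod (cm_integral M (povm_cm E \<psi> \<phi>) f - cm_integral M (povm_cm E \<psi>' \<phi>) f)
      \<le> C * norm (\<psi> - \<psi>')"
    using cm_integral_Lipschitz by blast
  have "\<bar>C\<bar>-lipschitz_on (form_domain M E f) (\<lambda>\<psi>. cm_integral M (povm_cm E \<psi> \<phi>) f)"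
    unfolding lipschitz_on_def dist_norm
    using order_trans[OF C mult_right_mono[OF abs_ge_self norm_ge_zero]] by simp
  then have "continuous_on (form_domain M E f) (\<lambda>\<psi>. cm_integral M (povm_cm E \<psi> \<phi>) f)"
    by (rule lipschitz_on_continuous_on)
  then show "\<phi> \<in> weak_domain M E f"
    using \<phi> square_domain_subset_form_domain[OF f] by (auto simp: weak_domain_def)
qed

lemma weak_domain_eq: "weak_domain M E f = square_domain M E f"
  using weak_domain_subset_square_domain square_domain_subset_weak_domain by blast

text \<open>Both sides depend continuously on \<open>\<psi>\<close>, so that a dense set of \<open>\<psi>\<close> suffices. The values of the
  strong and of the weak integral are thus described by equivalent conditions.\<close>

lemma represents_on_form_domain_iff:
  assumes \<phi>: "\<phi> \<in> square_domain M E f"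
  shows "(\<forall>\<psi>\<in>form_domain M E f. cinner \<psi> \<eta> = cm_integral M (povm_cm E \<psi> \<phi>) f)
    \<longleftrightarrow> (\<forall>\<psi>. cinner \<psi> \<eta> = cm_integral M (povm_cm E \<psi> \<phi>) f)"
proof safe
  fix \<psi>
  assume form: "\<forall>\<psi>\<in>form_domain M E f. cinner \<psi> \<eta> = cm_integral M (povm_cm E \<psi> \<phi>) f"
  obtain u where u: "\<And>n::nat. u n \<in> form_domain M E f" "u \<longlonglongrightarrow> \<psi>"
    using form_domain_dense[OF f] by blast
  obtain C where C: "\<And>\<psi> \<psi>'. cmod (cm_integral M (povm_cm E \<psi> \<phi>) f - cm_integral M (povm_cm E \<psi>' \<phi>) f)
      \<le> C * norm (\<psi> - \<psi>')"
    using cm_integral_Lipschitz[OF \<phi>] by blast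
  have "(\<lambda>n. C * norm (u n - \<psi>)) \<longlonglongrightarrow> C * norm (\<psi> - \<psi>)"
    by (intro tendsto_intros u)
  then have "(\<lambda>n. cm_integral M (povm_cm E (u n) \<phi>) f - cm_integral M (povm_cm E \<psi> \<phi>) f) \<longlonglongrightarrow> 0"
    by (intro Lim_null_comparison[OF always_eventually[OF allI[OF C]]]) simp
  then have "(\<lambda>n. cm_integral M (povm_cm E (u n) \<phi>) f) \<longlonglongrightarrow> cm_integral M (povm_cm E \<psi> \<phi>) f"
    by (rule LIM_zero_cancel)
  moreover have "(\<lambda>n. cnj (cinner \<eta> (u n))) \<longlonglongrightarrow> cnj (cinner \<eta> \<psi>)"
    by (intro tendsto_cnj tendsto_cinner_right u)
  then have "(\<lambda>n. cm_integral M (povm_cm E (u n) \<phi>) f) \<longlonglongrightarrow> cinner \<psi> \<eta>"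
    using form u(1) by (simp add: cinner_commute[symmetric])
  ultimately show "cinner \<psi> \<eta> = cm_integral M (povm_cm E \<psi> \<phi>) f"
    by (rule LIMSEQ_unique[rotated])
qed simp

lemma square_integral_eq: "square_integral M E f = strong_integral M E f"
  by (auto simp: square_integral_def restrict_map_def strong_integral_def strong_domain_eq)

lemma weak_integral_eq: "weak_integral M E f = strong_integral M E f"
  by (auto simp: fun_eq_iff weak_integral_def strong_integral_def strong_domain_eq weak_domain_eq
      represents_on_form_domain_iff)

end

theorem proposition12:
  fixes M :: "'o measure"
    and E :: "'o set \<Rightarrow> 'h::chilbert_space \<Rightarrow> 'h"
    and f :: "'o \<Rightarrow> complex"
  assumes "povm M E"
    and "f \<in> borel_measurable M"
    and "projection_valued M E"
  shows "square_integral M E f = strong_integral M E f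
    \<and> strong_integral M E f = weak_integral M E f"
proof -
  obtain s where s: "\<And>n::nat. simple_function M (s n)"
    "\<And>x. x \<in> space M \<Longrightarrow> (\<lambda>n. s n x) \<longlonglongrightarrow> f x"
    "\<And>n x. x \<in> space M \<Longrightarrow> cmod (s n x - f x) \<le> cmod (f x)"
    using simple_functions_close_to[OF assms(2)] by blast
  interpret simple_approximants M E f s
    by unfold_locales (use assms s in auto)
  show ?thesis
    by (simp add: square_integral_eq weak_integral_eq)
qed

end
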